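(* For every $d\ge1$ there are constants $c_1(d),c_2(d),c_3(d),N(d)>0$ such that the following holds. Let $p$ be a centered log-concave p.m.f. on $\mathbb{Z}^d$ which has an isotropic log-concave extension and whose covariance matrix is $\mathrm{Cov}(p)=\sigma^2 I_d$, with $\sigma=\det(\mathrm{Cov}(p))^{1/(2d)}\ge N(d)$. Then: (1) $\max_{k\in\mathbb{Z}^d}p(k)\le\frac{c_1(d)}{\sigma^d}$; (2) for every $k\in\mathbb{Z}^d$ with $\|k\|_\infty\ge c_2(d)\sigma$, $p(k)\le\frac{c_2(d)}{\sigma^d}e^{-\frac{\|k\|_1}{c_2(d)\sigma}}$; (3) $\sum_{i=1}^d\sum_{k\in\mathbb{Z}^d}|p(k)-p(k-e_i)|\le\frac{c_3(d)}{\sigma}$.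
   Context: For a p.m.f. $p$ on $\mathbb{Z}^d$, $\mathrm{Cov}(p)$ is its usual covariance matrix; $p$ is centered if $\sum_k k\,p(k)=0$. $e_1,\dots,e_d$ is the standard basis. $p:\mathbb{Z}^d\to\mathbb{R}_+$ is log-concave (meaning log-concave extensible) if $p=e^{-V}$ on $\mathbb{Z}^d$ where $V:\mathbb{Z}^d\to\mathbb{R}\cup\{+\infty\}$ agrees on $\mathbb{Z}^d$ with some convex function $\bar V:\mathbb{R}^d\to\mathbb{R}\cup\{+\infty\}$; $f=e^{-\bar V}$ is called an extension of $p$ (it need not be a density). An integrable $f:\mathbb{R}^d\to\mathbb{R}_+$ is isotropic if $\mathrm{Cov}(f)=s^2I_d$ for some $s>0$, where $[\mathrm{Cov}(f)]_{ij}=\frac{\int x_ix_jf}{\int f}-\frac{\int x_if\int x_jf}{(\int f)^2}$. *)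

theory Defs
  imports "HOL-Probability.Probability"
begin

text \<open>The lattice \<open>\<int>\<^sup>d\<close> is \<^typ>\<open>int ^ 'n\<close> and the space \<open>\<real>\<^sup>d\<close> is \<^typ>\<open>real ^ 'n\<close>, with
  \<open>d = CARD('n)\<close>. Lattice points are embedded in the space by \<open>real_vec\<close>.\<close>

definition real_vec :: "int ^ 'n \<Rightarrow> real ^ 'n" where
  "real_vec k = (\<chi> i. real_of_int (k $ i))"

definition norm_1 :: "real ^ 'n \<Rightarrow> real" where
  "norm_1 x = (\<Sum>i\<in>UNIV. \<bar>x $ i\<bar>)"

text \<open>Convexity for functions with values in \<open>\<real> \<union> {+\<infinity>}\<close>. On \<^typ>\<open>ereal\<close> we have \<open>0 * \<infinity> = 0\<close>,
  so the cases \<open>t = 0\<close> and \<open>t = 1\<close> are trivially satisfied.\<close>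

definition convex_ereal :: "(real ^ 'n \<Rightarrow> ereal) \<Rightarrow> bool" where
  "convex_ereal V \<longleftrightarrow>
     (\<forall>x. V x \<noteq> -\<infinity>) \<and>
     (\<forall>x y. \<forall>t\<in>{0..1}.
        V ((1 - t) *\<^sub>R x + t *\<^sub>R y) \<le> ereal (1 - t) * V x + ereal t * V y)"

text \<open>The function \<open>v \<mapsto> e\<^bsup>-v\<^esup>\<close> with \<open>e\<^bsup>-\<infinity>\<^esup> = 0\<close>; it is only applied to values \<open>v \<noteq> -\<infinity>\<close>.\<close>

definition exp_minus :: "ereal \<Rightarrow> real" where
  "exp_minus v = (if v = \<infinity> then 0 else exp (- real_of_ereal v))"

text \<open>\<open>W\<close> is a convex function on the whole space such that \<open>p = e\<^bsup>-V\<^esup>\<close> for some \<open>V\<close> which agrees with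
  \<open>W\<close> on the lattice.\<close>

definition convex_potential :: "(int ^ 'n \<Rightarrow> real) \<Rightarrow> (real ^ 'n \<Rightarrow> ereal) \<Rightarrow> bool" where
  "convex_potential p W \<longleftrightarrow>
     convex_ereal W \<and>
     (\<exists>V. (\<forall>k. V k = W (real_vec k)) \<and> (\<forall>k. p k = exp_minus (V k)))"

definition log_concave :: "(int ^ 'n \<Rightarrow> real) \<Rightarrow> bool" where
  "log_concave p \<longleftrightarrow> (\<exists>W. convex_potential p W)"

definition log_concave_extension :: "(int ^ 'n \<Rightarrow> real) \<Rightarrow> (real ^ 'n \<Rightarrow> real) \<Rightarrow> bool" where
  "log_concave_extension p f \<longleftrightarrow> (\<exists>W. convex_potential p W \<and> f = (\<lambda>x. exp_minus (W x)))"

text \<open>The integrals are taken with respect to \<^term>\<open>lebesgue\<close> rather than \<^term>\<open>lborel\<close>, because a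
  log-concave function need not be Borel measurable on the boundary of its support.\<close>

definition cov_fun :: "(real ^ 'n \<Rightarrow> real) \<Rightarrow> real ^ 'n ^ 'n" where
  "cov_fun f = (\<chi> i j.
     (LINT x|lebesgue. x $ i * x $ j * f x) / (LINT x|lebesgue. f x)
     - ((LINT x|lebesgue. x $ i * f x) * (LINT x|lebesgue. x $ j * f x)) / (LINT x|lebesgue. f x)\<^sup>2)"

text \<open>No integrability of the second moments has to be required here: if the \<open>i\<close>-th one were not
  finite, its integral would be \<open>0\<close> by convention and the \<open>i\<close>-th diagonal entry would not be
  positive. The same remark excludes \<open>f\<close> with integral \<open>0\<close>, and it applies to \<open>cov_pmf\<close> below
  whenever \<open>cov_pmf p = mat (\<sigma>\<^sup>2)\<close> with \<open>\<sigma> > 0\<close>.\<close>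

definition isotropic :: "(real ^ 'n \<Rightarrow> real) \<Rightarrow> bool" where
  "isotropic f \<longleftrightarrow>
     (\<forall>x. 0 \<le> f x) \<and> integrable lebesgue f \<and> (\<exists>s>0. cov_fun f = mat (s\<^sup>2))"

definition cov_pmf :: "(int ^ 'n) pmf \<Rightarrow> real ^ 'n ^ 'n" where
  "cov_pmf p = (\<chi> i j. measure_pmf.expectation p (\<lambda>k.
     (real_of_int (k $ i) - measure_pmf.expectation p (\<lambda>l. real_of_int (l $ i))) *
     (real_of_int (k $ j) - measure_pmf.expectation p (\<lambda>l. real_of_int (l $ j)))))"

definition centered :: "(int ^ 'n) pmf \<Rightarrow> bool" where
  "centered p \<longleftrightarrow> ((\<lambda>k. pmf p k *\<^sub>R real_vec k) has_sum 0) UNIV"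

end

theory Submission
  imports Defs
begin

text \<open>Write \<open>p = f\<close> on the lattice with \<open>f\<close> log-concave, let \<open>m\<close> be a mode of \<open>p\<close>, and consider the convex
  sets \<open>L a = {x. f x \<ge> p m * exp (- a)}\<close>. A convex set without a cube of side \<open>r\<close> lies in a slab of
  width comparable to \<open>r\<close>. On the other hand, once \<open>L a\<close> contains a unit cube, the lattice points of
  \<open>L (t * a)\<close> number at most a polynomial in \<open>t\<close> times those of \<open>L a\<close>, so \<open>p\<close> decays exponentially
  beyond \<open>L a\<close>. Doubling \<open>a\<close> from \<open>1\<close> until a cube of side \<open>c * \<sigma>\<close> fits, one sees that already \<open>L 1\<close>
  contains such a cube, as otherwise the variance of \<open>p\<close> in the direction of a slab would be less than
  \<open>\<sigma>\<^sup>2\<close>. This bounds \<open>p m\<close>; Chebyshev's inequality gives the matching lower bound; the cube and the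
  second moments force \<open>L 1\<close> into a ball of radius comparable to \<open>\<sigma>\<close>, whence the exponential tail by
  log-concavity along rays from \<open>m\<close>. Finally \<open>p\<close> is unimodal on lines, so its variation along each
  line is at most twice the maximum, and the maxima are summed with the tail bound.\<close>

section \<open>Cubes and slabs\<close>

text \<open>A closed ball of the sup norm: \<open>r\<close> is half the side length.\<close>

definition cube :: "real ^ 'n \<Rightarrow> real \<Rightarrow> (real ^ 'n) set" where
  "cube y r = {x. \<forall>i. \<bar>x $ i - y $ i\<bar> \<le> r}"

lemma row_combination:
  fixes A :: "real ^ 'n ^ 'n"
  shows "b v* A = (\<Sum>i\<in>UNIV. b $ i *\<^sub>R row i A)"
  by (simp add: vec_eq_iff vector_matrix_mult_def row_def mult.commute)

text \<open>A maximal independent subset of \<open>D\<close> is a basis, so it has as many elements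
  as the index type and can be listed as the rows of a square matrix. Spanning rows give a left
  inverse, hence a nonzero determinant.\<close>

lemma nonsingular_rows_from_spanning_set:
  fixes D :: "(real ^ 'n) set"
  assumes "span D = UNIV"
  obtains w :: "'n \<Rightarrow> real ^ 'n" where "\<And>i. w i \<in> D" "det (\<chi> i. w i) \<noteq> 0"
proof -
  obtain B where B: "B \<subseteq> D" "independent B" "D \<subseteq> span B"
    using maximal_independent_subset by blast
  have sB: "span B = UNIV"
    using B(3) assms by (metis span_mono span_span top.extremum_uniqueI)
  have fB: "finite B"
    using B(2) independent_imp_finite by blast
  have "card B = dim (span B)"
    using B(2) by (simp add: dim_eq_card_independent)
  then have "card B = CARD('n)"
    by (simp add: sB)
  then obtain w :: "'n \<Rightarrow> real ^ 'n" where w: "bij_betw w UNIV B"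
    using finite_same_card_bij[OF finite_class.finite_UNIV fB] by auto
  have rows: "rows (\<chi> i. w i) = B"
    using w by (auto simp: rows_def row_def bij_betw_def vec_lambda_eta)
  have "\<exists>C. C ** (\<chi> i. w i) = mat 1"
    unfolding matrix_left_invertible_span_rows rows by (rule sB)
  then have "det (\<chi> i. w i) \<noteq> 0"
    by (metis invertible_det_nz invertible_left_inverse)
  moreover have "w i \<in> D" for i
    using w B(1) by (auto simp: bij_betw_def)
  ultimately show ?thesis
    using that by blast
qed

text \<open>The vectors \<open>w i\<close> are chosen from \<open>x - m\<close>, \<open>x \<in> E\<close>, so as to maximise the determinant. By
  Cramer's rule all coordinates of \<open>E - m\<close> with respect to \<open>w\<close> are then at most \<open>1\<close> in absolute
  value, so that the simplex spanned by \<open>m\<close> and the \<open>m + w i\<close> has the shape of \<open>E\<close> up to constants.\<close>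

lemma cube_or_slab:
  fixes E :: "(real ^ 'n) set"
  assumes fin: "finite E" and m: "m \<in> E" and R: "R > 0"
  shows "(\<exists>y. cube y R \<subseteq> convex hull E) \<or>
         (\<exists>\<theta>. norm \<theta> = 1 \<and> (\<forall>x\<in>E. \<bar>(x - m) \<bullet> \<theta>\<bar> \<le> 2 * real CARD('n) ^ 2 * R))"
proof (cases "span ((\<lambda>x. x - m) ` E) = UNIV")
  \<comment> \<open>Here \<open>E\<close> lies in a hyperplane through \<open>m\<close>, that is, in
    a slab of width zero.\<close>
  case False
  then obtain a where a: "a \<noteq> 0" "\<And>x. x \<in> span ((\<lambda>x. x - m) ` E) \<Longrightarrow> a \<bullet> x = 0"
    using span_not_univ_subset_hyperplane by blast
  have "\<bar>(x - m) \<bullet> (a /\<^sub>R norm a)\<bar> \<le> 2 * real CARD('n) ^ 2 * R" if "x \<in> E" for x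
  proof -
    have "a \<bullet> (x - m) = 0"
      using a(2) that by (simp add: span_base)
    then show ?thesis
      using R by (simp add: inner_commute)
  qed
  moreover have "norm (a /\<^sub>R norm a) = 1"
    using a by simp
  ultimately show ?thesis by blast
next
  case True
  define D where "D = (\<lambda>x. x - m) ` E"
  define d where "d = real CARD('n)"
  have d: "d \<ge> 1"
    using zero_less_card_finite[where 'a='n] unfolding d_def by linarith
  have finD: "finite D"
    using fin by (simp add: D_def)
  define T where "T = {w :: 'n \<Rightarrow> real ^ 'n. \<forall>i. w i \<in> D}"
  have "T = (\<Pi>\<^sub>E i\<in>UNIV. D)"
    by (auto simp: T_def PiE_def)
  then have finT: "finite T"
    using finD by (simp add: finite_PiE)
  obtain w0 where w0: "w0 \<in> T" "det (\<chi> i. w0 i) \<noteq> 0"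
  proof -
    obtain w0 :: "'n \<Rightarrow> real ^ 'n" where "\<And>i. w0 i \<in> (\<lambda>x. x - m) ` E" "det (\<chi> i. w0 i) \<noteq> 0"
      using nonsingular_rows_from_spanning_set[OF True] by blast
    then show ?thesis
      using that[of w0] by (simp add: T_def D_def)
  qed
  have "Max ((\<lambda>w. \<bar>det (\<chi> i. w i)\<bar>) ` T) \<in> (\<lambda>w. \<bar>det (\<chi> i. w i)\<bar>) ` T"
    using finT w0(1) by (intro Max_in) auto
  then obtain w where w: "w \<in> T" "Max ((\<lambda>w. \<bar>det (\<chi> i. w i)\<bar>) ` T) = \<bar>det (\<chi> i. w i)\<bar>"
    by blast
  have "\<bar>det (\<chi> i. u i)\<bar> \<le> \<bar>det (\<chi> i. w i)\<bar>" if "u \<in> T" for u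
    unfolding w(2)[symmetric] using finT that by (intro Max_ge) auto
  with w(1) have wT: "\<And>i. w i \<in> D" and wmax: "\<And>u. u \<in> T \<Longrightarrow> \<bar>det (\<chi> i. u i)\<bar> \<le> \<bar>det (\<chi> i. w i)\<bar>"
    by (auto simp: T_def)
  define A where "A = (\<chi> i. w i)"
  have rowA: "row i A = w i" for i
    by (simp add: A_def row_def vec_lambda_eta)
  have detA: "det A \<noteq> 0"
    using wmax[OF w0(1)] w0(2) by (auto simp: A_def)
  obtain B where B: "A ** B = mat 1" "B ** A = mat 1"
    using detA invertible_det_nz invertible_def by metis
  \<comment> \<open>As \<open>B\<close> inverts \<open>A\<close>, the entries of
    \<open>z v* B\<close> are the coordinates of \<open>z\<close> in the basis
    \<open>w\<close>.\<close>
  have expand: "(\<Sum>i\<in>UNIV. (z v* B) $ i *\<^sub>R w i) = z" for z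
  proof -
    have "(z v* B) v* A = z"
      by (simp add: vector_matrix_mul_assoc B)
    then show ?thesis
      by (simp add: row_combination rowA)
  qed
  have coord: "\<bar>((x - m) v* B) $ k\<bar> \<le> 1" if "x \<in> E" for x k
  proof -
    let ?b = "(x - m) v* B"
    have "det (\<chi> i. if i = k then sum (\<lambda>i. ?b $ i *s row i A) UNIV else row i A) = ?b $ k * det A"
      by (rule cramer_lemma_transpose)
    moreover have "sum (\<lambda>i. ?b $ i *s row i A) UNIV = x - m"
      using expand[of "x - m"] by (simp add: rowA scalar_mult_eq_scaleR)
    ultimately have eq: "det (\<chi> i. if i = k then x - m else w i) = ?b $ k * det A"
      by (simp only: rowA)
    have "(\<lambda>i. if i = k then x - m else w i) \<in> T"
      using that wT by (auto simp: T_def D_def)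
    from wmax[OF this] have "\<bar>?b $ k\<bar> * \<bar>det A\<bar> \<le> 1 * \<bar>det A\<bar>"
      unfolding eq by (simp add: A_def abs_mult)
    then show ?thesis
      using detA by (simp add: mult_le_cancel_right)
  qed
  show ?thesis
  proof (cases "\<exists>\<theta>. norm \<theta> = 1 \<and> (\<Sum>j\<in>UNIV. \<bar>w j \<bullet> \<theta>\<bar>) \<le> 2 * d ^ 2 * R")
    \<comment> \<open>All coordinates of \<open>x - m\<close> being at most 1 in absolute value, the
      widths of the \<open>w j\<close> in the direction \<theta> add up to a bound for the width of
      \<open>E\<close>.\<close>
    case True
    then obtain \<theta> where th: "norm \<theta> = 1" "(\<Sum>j\<in>UNIV. \<bar>w j \<bullet> \<theta>\<bar>) \<le> 2 * d ^ 2 * R" by blast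
    have "\<bar>(x - m) \<bullet> \<theta>\<bar> \<le> 2 * d ^ 2 * R" if "x \<in> E" for x
    proof -
      have "(x - m) \<bullet> \<theta> = (\<Sum>i\<in>UNIV. ((x - m) v* B) $ i * (w i \<bullet> \<theta>))"
        by (subst (1) expand[of "x - m", symmetric]) (simp add: inner_sum_left)
      also have "\<bar>\<dots>\<bar> \<le> (\<Sum>i\<in>UNIV. \<bar>((x - m) v* B) $ i\<bar> * \<bar>w i \<bullet> \<theta>\<bar>)"
        by (rule order_trans[OF sum_abs]) (simp add: abs_mult)
      also have "\<dots> \<le> (\<Sum>i\<in>UNIV. 1 * \<bar>w i \<bullet> \<theta>\<bar>)"
        by (intro sum_mono mult_right_mono coord that) auto
      finally show ?thesis using th(2) by simp
    qed
    then show ?thesis using th(1) by (auto simp: d_def)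
  next
    case False
    define \<rho> where "\<rho> = 2 * d ^ 2 * R"
    have rho: "\<rho> > 0" using d R by (simp add: \<rho>_def)
    have wide: "\<rho> * norm u \<le> (\<Sum>j\<in>UNIV. \<bar>w j \<bullet> u\<bar>)" for u
    proof (cases "u = 0")
      case nz: False
      have "\<rho> < (\<Sum>j\<in>UNIV. \<bar>w j \<bullet> (u /\<^sub>R norm u)\<bar>)"
      proof -
        have "norm (u /\<^sub>R norm u) = 1" using nz by simp
        then show ?thesis using False unfolding \<rho>_def not_le[symmetric] by blast
      qed
      also have "\<dots> = (\<Sum>j\<in>UNIV. \<bar>w j \<bullet> u\<bar>) / norm u"
        by (simp add: sum_distrib_left[symmetric] abs_mult divide_inverse mult.commute)
      finally show ?thesis
        using nz by (simp add: field_simps)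
    qed auto
    \<comment> \<open>The \<open>k\<close>-th coordinate of \<open>z\<close> is its inner product
      with the dual basis vector \<open>u\<close>. In \<open>wide\<close> the right-hand side equals
      1 for this \<open>u\<close>, which bounds its norm.\<close>
    have coord_bound: "\<bar>(z v* B) $ k\<bar> \<le> norm z / \<rho>" for z k
    proof -
      define u where "u = B *v axis k 1"
      have "A *v u = axis k 1"
        by (simp add: u_def matrix_vector_mul_assoc B)
      then have "w j \<bullet> u = axis k 1 $ j" for j
        by (metis matrix_vector_mul_component row_def rowA vec_lambda_eta)
      then have "(\<Sum>j\<in>UNIV. \<bar>w j \<bullet> u\<bar>) = (\<Sum>j\<in>UNIV. if j = k then 1 else 0)"
        by (intro sum.cong) (auto simp: axis_def)
      then have u: "\<rho> * norm u \<le> 1"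
        using wide[of u] by simp
      have "(z v* B) $ k = (z v* B) \<bullet> axis k 1"
        by (simp add: inner_axis)
      also have "\<dots> = z \<bullet> u"
        by (simp add: u_def dot_lmul_matrix)
      finally have "\<bar>(z v* B) $ k\<bar> \<le> norm z * norm u"
        by (simp add: Cauchy_Schwarz_ineq2)
      also have "\<dots> \<le> norm z * (1 / \<rho>)"
        using u rho by (intro mult_left_mono) (auto simp: field_simps)
      finally show ?thesis by simp
    qed
    \<comment> \<open>The centre has weight \<open>1 / (2 * d)\<close> at each
      \<open>m + w i\<close> and weight one half at \<open>m\<close>. The factor in \<rho> is chosen
      so that moving inside the cube changes each coordinate by at most \<open>1 / (2 * d)\<close>:
      the weights stay nonnegative and the one at \<open>m\<close> does too.\<close>
    define y where "y = m + (\<Sum>i\<in>UNIV. (1 / (2 * d)) *\<^sub>R w i)"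
    have "cube y R \<subseteq> convex hull E"
    proof
      fix x assume "x \<in> cube y R"
      then have xy: "\<And>i. \<bar>(x - y) $ i\<bar> \<le> R" by (simp add: cube_def)
      have "norm (x - y) \<le> (\<Sum>i\<in>(UNIV::'n set). \<bar>(x - y) $ i\<bar>)"
        by (rule norm_le_l1_cart)
      also have "\<dots> \<le> d * R"
        using sum_bounded_above[of "UNIV :: 'n set" "\<lambda>i. \<bar>(x - y) $ i\<bar>" R] xy by (simp add: d_def)
      finally have nrm: "norm (x - y) \<le> d * R" .
      define b where "b i = 1 / (2 * d) + ((x - y) v* B) $ i" for i
      have small: "\<bar>((x - y) v* B) $ i\<bar> \<le> 1 / (2 * d)" for i
      proof -
        have "norm (x - y) / \<rho> \<le> (d * R) / \<rho>"
          using nrm rho by (simp add: divide_right_mono)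
        also have "\<dots> = 1 / (2 * d)"
          using d R by (simp add: \<rho>_def power2_eq_square field_simps)
        finally show ?thesis using coord_bound[of "x - y" i] by linarith
      qed
      have b0: "0 \<le> b i" and b1: "b i \<le> 1 / d" for i
        using small[of i] d by (auto simp: b_def abs_le_iff field_simps)
      have bsum: "(\<Sum>i\<in>UNIV. b i) \<le> 1"
        using sum_bounded_above[of "UNIV :: 'n set" b "1 / d"] b1 d by (simp add: d_def)
      have x: "x = m + (\<Sum>i\<in>UNIV. b i *\<^sub>R w i)"
      proof -
        have "(\<Sum>i\<in>UNIV. b i *\<^sub>R w i) = (\<Sum>i\<in>UNIV. (1 / (2 * d)) *\<^sub>R w i) + (x - y)"
          by (simp only: b_def scaleR_left_distrib sum.distrib expand)
        then show ?thesis by (simp add: y_def)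
      qed
      have inE: "m + w i \<in> convex hull E" for i
        using wT[of i] by (auto simp: D_def hull_inc)
      have "(1 - (\<Sum>i\<in>UNIV. b i)) *\<^sub>R m + (\<Sum>i\<in>UNIV. b i *\<^sub>R (m + w i)) \<in> convex hull E"
      proof -
        \<comment> \<open>The type \<open>option\<close> over the index type enumerates the vertices
          of the simplex, with \<open>None\<close> for \<open>m\<close>.\<close>
        have "(\<Sum>i\<in>UNIV. case_option (1 - sum b UNIV) b i *\<^sub>R case_option m (\<lambda>i. m + w i) i) \<in> convex hull E"
          using inE m b0 bsum
          by (intro convex_sum) (auto simp: UNIV_option_conv sum.reindex hull_inc split: option.split)
        then show ?thesis
          by (simp add: UNIV_option_conv sum.reindex)
      qed
      also have "(1 - (\<Sum>i\<in>UNIV. b i)) *\<^sub>R m + (\<Sum>i\<in>UNIV. b i *\<^sub>R (m + w i)) = x"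
        by (simp add: x scaleR_right_distrib sum.distrib scaleR_left_diff_distrib scaleR_left.sum)
      finally show "x \<in> convex hull E" .
    qed
    then show ?thesis by blast
  qed
qed

section \<open>Lattice points and moments\<close>

lemma bij_betw_vec_box:
  "bij_betw vec_nth {k :: 'a ^ 'n. \<forall>i. k $ i \<in> S i} (Pi\<^sub>E UNIV S)"
  by (rule bij_betw_byWitness[where f' = vec_lambda]) (auto simp: PiE_def)

lemma finite_vec_box:
  assumes "\<And>i. finite (S i)"
  shows "finite {k :: 'a ^ 'n. \<forall>i. k $ i \<in> S i}"
  using bij_betw_finite[OF bij_betw_vec_box[of S]] assms by (simp add: finite_PiE)

lemma card_vec_box:
  "card {k :: 'a ^ 'n. \<forall>i. k $ i \<in> S i} = (\<Prod>i\<in>UNIV. card (S i))"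
  using bij_betw_same_card[OF bij_betw_vec_box[of S]] by (simp add: card_PiE)

lemma sum_vec_box:
  fixes g :: "'n::finite \<Rightarrow> 'a \<Rightarrow> 'b::comm_semiring_1"
  assumes "\<And>i. finite (S i)"
  shows "(\<Sum>k\<in>{k :: 'a ^ 'n. \<forall>i. k $ i \<in> S i}. \<Prod>i\<in>UNIV. g i (k $ i)) = (\<Prod>i\<in>UNIV. \<Sum>x\<in>S i. g i x)"
proof -
  have "(\<Sum>k\<in>{k :: 'a ^ 'n. \<forall>i. k $ i \<in> S i}. \<Prod>i\<in>UNIV. g i (k $ i))
      = (\<Sum>h\<in>Pi\<^sub>E UNIV S. \<Prod>i\<in>UNIV. g i (h i))"
    by (rule sum.reindex_bij_betw[OF bij_betw_vec_box])
  also have "\<dots> = (\<Prod>i\<in>UNIV. \<Sum>x\<in>S i. g i x)"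
    using assms by (subst prod_sum_PiE) auto
  finally show ?thesis .
qed

lemma int_interval: "{k :: int. \<bar>real_of_int k - y\<bar> \<le> r} = {\<lceil>y - r\<rceil>..\<lfloor>y + r\<rfloor>}"
  by (auto simp: abs_le_iff le_floor_iff ceiling_le_iff)

text \<open>An interval of length \<open>2 * r\<close> contains more than \<open>2 * r - 1\<close>
  integers, and this is at least \<open>r\<close> once \<open>r \<ge> 1\<close>.\<close>

lemma card_int_interval_ge:
  assumes "r \<ge> 1"
  shows "r \<le> real (card {k :: int. \<bar>real_of_int k - y\<bar> \<le> r})"
  unfolding int_interval using assms by (simp add: of_nat_nat) linarith

lemma card_int_interval_le:
  assumes "r \<ge> 0"
  shows "real (card {k :: int. \<bar>real_of_int k - y\<bar> \<le> r}) \<le> 2 * r + 1"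
proof -
  have "\<lfloor>y + r\<rfloor> + 1 - \<lceil>y - r\<rceil> \<le> 2 * r + 1"
    using of_int_floor_le[of "y + r"] le_of_int_ceiling[of "y - r"] by simp linarith
  then show ?thesis
    unfolding int_interval using assms by (cases "\<lfloor>y + r\<rfloor> + 1 - \<lceil>y - r\<rceil> \<ge> 0") auto
qed

lemma lattice_cube: "{k. real_vec k \<in> cube y r} = {k. \<forall>i. k $ i \<in> {n. \<bar>real_of_int n - y $ i\<bar> \<le> r}}"
  by (simp add: cube_def real_vec_def)

lemma finite_lattice_cube: "finite {k. real_vec k \<in> cube y r}"
  unfolding lattice_cube by (rule finite_vec_box) (simp add: int_interval)

lemma card_lattice_cube_ge:
  fixes y :: "real ^ 'n"
  assumes "r \<ge> 1"
  shows "r ^ CARD('n) \<le> real (card {k. real_vec k \<in> cube y r})"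
proof -
  have "(\<Prod>i\<in>(UNIV::'n set). r) \<le> (\<Prod>i\<in>UNIV. real (card {n. \<bar>real_of_int n - y $ i\<bar> \<le> r}))"
    using assms by (intro prod_mono) (auto intro: card_int_interval_ge)
  then show ?thesis
    unfolding lattice_cube card_vec_box by simp
qed

lemma card_lattice_cube_le:
  fixes y :: "real ^ 'n"
  assumes "r \<ge> 0"
  shows "real (card {k. real_vec k \<in> cube y r}) \<le> (2 * r + 1) ^ CARD('n)"
proof -
  have "(\<Prod>i\<in>UNIV. real (card {n. \<bar>real_of_int n - y $ i\<bar> \<le> r})) \<le> (\<Prod>i\<in>(UNIV::'n set). 2 * r + 1)"
    using assms by (intro prod_mono) (auto intro: card_int_interval_le)
  then show ?thesis
    unfolding lattice_cube card_vec_box by simp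
qed

section \<open>Expectations as unordered sums, and the first two moments\<close>

lemma integrable_pmf_weight:
  fixes g :: "'a \<Rightarrow> real"
  shows "integrable (measure_pmf p) g \<longleftrightarrow> (\<lambda>k. pmf p k * g k) summable_on UNIV"
proof -
  have "integrable (measure_pmf p) g \<longleftrightarrow> integrable (count_space UNIV) (\<lambda>k. pmf p k *\<^sub>R g k)"
    unfolding measure_pmf_eq_density by (rule integrable_density) simp_all
  also have "\<dots> \<longleftrightarrow> Infinite_Set_Sum.abs_summable_on (\<lambda>k. pmf p k * g k) UNIV"
    unfolding Infinite_Set_Sum.abs_summable_on_def by simp
  \<comment> \<open>For real families unordered summability is the same as absolute
    summability.\<close>
  also have "\<dots> \<longleftrightarrow> (\<lambda>k. pmf p k * g k) summable_on UNIV"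
    unfolding abs_summable_equivalent[symmetric] by (rule summable_on_iff_abs_summable_on_real[symmetric])
  finally show ?thesis .
qed

lemma has_sum_expectation:
  fixes g :: "'a \<Rightarrow> real"
  assumes "integrable (measure_pmf p) g"
  shows "((\<lambda>k. pmf p k * g k) has_sum measure_pmf.expectation p g) UNIV"
proof -
  have sum: "(\<lambda>k. pmf p k * g k) summable_on UNIV"
    using assms by (simp only: integrable_pmf_weight)
  have abs: "Infinite_Set_Sum.abs_summable_on (\<lambda>k. pmf p k * g k) UNIV"
    unfolding abs_summable_equivalent[symmetric] using sum by (rule summable_on_iff_abs_summable_on_real[THEN iffD1])
  have "measure_pmf.expectation p g = (LINT k|count_space UNIV. pmf p k *\<^sub>R g k)"
    unfolding measure_pmf_eq_density by (rule integral_density) simp_all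
  also have "\<dots> = infsetsum (\<lambda>k. pmf p k * g k) UNIV"
    unfolding infsetsum_def by simp
  also have "\<dots> = infsum (\<lambda>k. pmf p k * g k) UNIV"
    by (rule infsetsum_infsum[OF abs])
  finally show ?thesis
    using has_sum_infsum[OF sum] by (simp only:)
qed

lemma has_sum_vec_nth:
  fixes f :: "'a \<Rightarrow> real ^ 'n"
  assumes "(f has_sum s) A"
  shows "((\<lambda>x. f x $ i) has_sum s $ i) A"
  using has_sum_bounded_linear[OF bounded_linear_vec_nth assms] by (simp add: o_def)

lemma centered_isotropic_moments:
  fixes p :: "(int ^ 'n) pmf"
  assumes cent: "centered p" and cov: "cov_pmf p = mat (s\<^sup>2)" and s: "s > 0"
  shows "((\<lambda>k. pmf p k * real_of_int (k $ i)) has_sum 0) UNIV"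
    and "((\<lambda>k. pmf p k * (real_of_int (k $ i) * real_of_int (k $ j))) has_sum (if i = j then s\<^sup>2 else 0)) UNIV"
proof -
  have mean: "((\<lambda>k. pmf p k * real_of_int (k $ i)) has_sum 0) UNIV" for i
    using has_sum_vec_nth[OF cent[unfolded centered_def], of i] by (simp add: real_vec_def)
  then show "((\<lambda>k. pmf p k * real_of_int (k $ i)) has_sum 0) UNIV" .
  have int1: "integrable (measure_pmf p) (\<lambda>k. real_of_int (k $ i))" for i
    unfolding integrable_pmf_weight using mean[of i] by (rule has_sum_imp_summable)
  have E0: "measure_pmf.expectation p (\<lambda>k. real_of_int (k $ i)) = 0" for i
    using has_sum_unique[OF mean has_sum_expectation[OF int1]] by simp
  have E2: "measure_pmf.expectation p (\<lambda>k. real_of_int (k $ i) * real_of_int (k $ j)) = (if i = j then s\<^sup>2 else 0)" for i j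
    using arg_cong[OF cov, of "\<lambda>A. A $ i $ j"] by (simp add: cov_pmf_def E0 mat_def)
  \<comment> \<open>Were the square not integrable, its expectation would be 0 by convention,
    against the positive diagonal entry of the covariance. Mixed products are then dominated by sums
    of squares.\<close>
  have int2: "integrable (measure_pmf p) (\<lambda>k. real_of_int (k $ i) * real_of_int (k $ i))" for i
  proof (rule ccontr)
    assume "\<not> ?thesis"
    then have "measure_pmf.expectation p (\<lambda>k. real_of_int (k $ i) * real_of_int (k $ i)) = 0"
      by (rule not_integrable_integral_eq)
    then show False
      using E2[of i i] s by simp
  qed
  have "integrable (measure_pmf p) (\<lambda>k. real_of_int (k $ i) * real_of_int (k $ j))"
  proof (rule Bochner_Integration.integrable_bound)
    show "integrable (measure_pmf p) (\<lambda>k. real_of_int (k $ i) * real_of_int (k $ i) + real_of_int (k $ j) * real_of_int (k $ j))"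
      using int2 by simp
    have "\<bar>a * b\<bar> \<le> \<bar>a * a + b * b\<bar>" for a b :: real
    proof -
      have "2 * (\<bar>a\<bar> * \<bar>b\<bar>) \<le> a * a + b * b"
        using zero_le_power2[of "\<bar>a\<bar> - \<bar>b\<bar>"] by (simp add: power2_eq_square algebra_simps)
      moreover have "0 \<le> \<bar>a\<bar> * \<bar>b\<bar>" by simp
      ultimately have "\<bar>a\<bar> * \<bar>b\<bar> \<le> a * a + b * b" by linarith
      then show ?thesis by (simp add: abs_mult)
    qed
    then show "AE k in measure_pmf p. norm (real_of_int (k $ i) * real_of_int (k $ j))
      \<le> norm (real_of_int (k $ i) * real_of_int (k $ i) + real_of_int (k $ j) * real_of_int (k $ j))"
      by simp
  qed auto
  from has_sum_expectation[OF this]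
  show "((\<lambda>k. pmf p k * (real_of_int (k $ i) * real_of_int (k $ j))) has_sum (if i = j then s\<^sup>2 else 0)) UNIV"
    by (simp only: E2)
qed

section \<open>Level sets on the lattice\<close>

text \<open>The three factors of the \<open>n\<close>-th term belong to the layer of depth about
  \<open>n\<close> units: the squared relative displacement, the growth factor of
  \<open>level_growth\<close> at \<open>t = n + 1\<close>, and the decay of the mass.\<close>

definition layer_sum :: "nat \<Rightarrow> real" where
  "layer_sum d = (\<Sum>n. (2 * (real n + 1))\<^sup>2 * (4 * real n + 5) ^ d * exp (1 - real n))"

text \<open>A single term of the exponential series is at most its sum.\<close>

lemma power_le_fact_exp:
  fixes x :: real
  assumes "0 \<le> x"
  shows "x ^ q \<le> fact q * exp x"
proof -
  have "(\<Sum>n\<in>{q}. x ^ n /\<^sub>R fact n) \<le> exp x"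
    unfolding exp_def using assms by (intro sum_le_suminf summable_exp_generic) auto
  then show ?thesis
    by (simp add: field_simps)
qed

text \<open>Applied to \<open>(4 * n + 5) / 8\<close>, \<open>power_le_fact_exp\<close> bounds the
  polynomial by a multiple of \<open>exp (n / 2)\<close>, so a geometric series of ratio
  \<open>exp (- (1 / 2))\<close> dominates.\<close>

lemma summable_layers:
  "summable (\<lambda>n. (2 * (real n + 1))\<^sup>2 * (4 * real n + 5) ^ d * exp (1 - real n))"
proof (rule summable_comparison_test_ev)
  define K where "K = 8 ^ (d + 2) * fact (d + 2) * exp (5 / 8) * exp (1 :: real)"
  show "summable (\<lambda>n. K * exp (- (1 / 2)) ^ n)"
    by (intro summable_mult summable_geometric) simp
  have "(2 * (real n + 1))\<^sup>2 * (4 * real n + 5) ^ d * exp (1 - real n) \<le> K * exp (- (1 / 2)) ^ n" for n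
  proof -
    have "(2 * (real n + 1))\<^sup>2 * (4 * real n + 5) ^ d \<le> (4 * real n + 5)\<^sup>2 * (4 * real n + 5) ^ d"
      by (intro mult_right_mono power_mono) auto
    also have "\<dots> = 8 ^ (d + 2) * ((4 * real n + 5) / 8) ^ (d + 2)"
      by (simp add: power_add power_divide power2_eq_square)
    also have "\<dots> \<le> 8 ^ (d + 2) * (fact (d + 2) * exp ((4 * real n + 5) / 8))"
      by (intro mult_left_mono power_le_fact_exp) auto
    also have "exp ((4 * real n + 5) / 8) = exp (5 / 8) * exp (real n / 2)"
      by (simp add: exp_add[symmetric] field_simps)
    finally have "(2 * (real n + 1))\<^sup>2 * (4 * real n + 5) ^ d * exp (1 - real n)
       \<le> 8 ^ (d + 2) * (fact (d + 2) * (exp (5 / 8) * exp (real n / 2))) * exp (1 - real n)"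
      by (rule mult_right_mono) simp
    also have "\<dots> = K * (exp (real n / 2) * exp (- real n))"
      by (simp add: K_def exp_diff exp_minus field_simps)
    also have "exp (real n / 2) * exp (- real n) = exp (- (1 / 2)) ^ n"
      by (simp add: exp_add[symmetric] exp_of_nat_mult[symmetric])
    finally show ?thesis .
  qed
  then show "\<forall>\<^sub>F n in sequentially. norm ((2 * (real n + 1))\<^sup>2 * (4 * real n + 5) ^ d * exp (1 - real n))
      \<le> K * exp (- (1 / 2)) ^ n"
    by (intro always_eventually) (simp add: abs_mult)
qed

lemma sum_layers_le:
  assumes "finite I"
  shows "(\<Sum>n\<in>I. (2 * (real n + 1))\<^sup>2 * (4 * real n + 5) ^ d * exp (1 - real n)) \<le> layer_sum d"
  unfolding layer_sum_def using assms by (intro sum_le_suminf summable_layers) auto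

lemma layer_sum_ge_1: "1 \<le> layer_sum d"
proof -
  have "1 * 1 \<le> 5 ^ d * exp (1 :: real)"
    by (intro mult_mono) auto
  then have "1 \<le> 4 * (5 ^ d * exp (1 :: real))"
    by simp
  also have "\<dots> = (\<Sum>n\<in>{0}. (2 * (real n + 1))\<^sup>2 * (4 * real n + 5) ^ d * exp (1 - real n))"
    by simp
  also have "\<dots> \<le> layer_sum d"
    by (rule sum_layers_le) simp
  finally show ?thesis .
qed

lemma has_sum_finite_sum:
  fixes f :: "'b \<Rightarrow> 'a \<Rightarrow> real"
  assumes "finite I" "\<And>i. i \<in> I \<Longrightarrow> (f i has_sum c i) A"
  shows "((\<lambda>x. \<Sum>i\<in>I. f i x) has_sum (\<Sum>i\<in>I. c i)) A"
  using assms by (induction I rule: finite_induct) (auto intro!: has_sum_add)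

lemma card_le_fibers:
  assumes fin: "finite F" "finite K" and img: "w ` F \<subseteq> K"
    and B: "\<And>v. v \<in> K \<Longrightarrow> real (card {k \<in> F. w k = v}) \<le> B"
  shows "real (card F) \<le> B * real (card K)"
proof -
  have "F = (\<Union>v\<in>K. {k \<in> F. w k = v})"
    using img by auto
  then have "card F \<le> (\<Sum>v\<in>K. card {k \<in> F. w k = v})"
    using card_UN_le[OF fin(2)] by metis
  then have "real (card F) \<le> (\<Sum>v\<in>K. real (card {k \<in> F. w k = v}))"
    by (metis of_nat_le_iff of_nat_sum)
  also have "\<dots> \<le> (\<Sum>v\<in>K. B)"
    by (intro sum_mono B)
  finally show ?thesis by (simp add: mult.commute)
qed

text \<open>The set \<open>L a\<close> stands for \<open>{x. f x \<ge> p m * exp (- a)}\<close>, where \<open>f\<close> is a log-concave extension of \<open>p\<close>.\<close>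

locale lattice_level_sets =
  fixes p :: "int ^ 'n \<Rightarrow> real" and L :: "real \<Rightarrow> (real ^ 'n) set" and m :: "int ^ 'n" and s :: real
  assumes nonneg: "0 \<le> p k"
    and total: "(p has_sum 1) UNIV"
    and mean: "((\<lambda>k. p k * real_of_int (k $ i)) has_sum 0) UNIV"
    and second_moment:
      "((\<lambda>k. p k * (real_of_int (k $ i) * real_of_int (k $ j))) has_sum (if i = j then s\<^sup>2 else 0)) UNIV"
    and s_pos: "0 < s"
    and mode_pos: "0 < p m"
    and mode: "p k \<le> p m"
    and level_combine: "\<lbrakk>x \<in> L a; y \<in> L b; 0 \<le> t; t \<le> 1\<rbrakk> \<Longrightarrow> (1 - t) *\<^sub>R x + t *\<^sub>R y \<in> L ((1 - t) * a + t * b)"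
    and level_mono: "a \<le> b \<Longrightarrow> L a \<subseteq> L b"
    and level_lattice: "real_vec k \<in> L a \<longleftrightarrow> p m * exp (- a) \<le> p k"
begin

text \<open>The least level containing \<open>k\<close>, meaningful only where \<open>p k\<close> is
  positive; hence the positivity assumptions below.\<close>

definition depth :: "int ^ 'n \<Rightarrow> real" where "depth k = ln (p m / p k)"

lemma depth_nonneg: "0 < p k \<Longrightarrow> 0 \<le> depth k"
  using mode[of k] mode_pos by (simp add: depth_def)

lemma p_eq_depth: "0 < p k \<Longrightarrow> p k = p m * exp (- depth k)"
  using mode_pos by (simp add: depth_def ln_div exp_diff)

lemma in_level_depth: "0 < p k \<Longrightarrow> real_vec k \<in> L (depth k)"
  using p_eq_depth by (simp add: level_lattice)

lemma mode_in_level: "real_vec m \<in> L 0"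
  by (simp add: level_lattice)

lemma convex_level: "convex (L a)"
  unfolding convex_alt using level_combine[of _ a _ a] by (auto simp: algebra_simps)

text \<open>The mode lies in \<open>L 0\<close>, so only the weight \<open>1 / t\<close> of
  \<open>x\<close> contributes to the level, which is thereby divided by \<open>t\<close>.\<close>

lemma contract_to_mode:
  assumes "x \<in> L (t * a)" "t \<ge> 1"
  shows "(1 - 1 / t) *\<^sub>R real_vec m + (1 / t) *\<^sub>R x \<in> L a"
  using level_combine[OF mode_in_level assms(1), of "1 / t"] assms(2) by simp

lemma sum_le_1: "finite F \<Longrightarrow> sum p F \<le> 1"
  using finite_sum_le_has_sum[OF total] nonneg by simp

text \<open>Each such point carries mass at least \<open>p m * exp (- a)\<close>, so the total mass
  limits how many there can be.\<close>

lemma mode_level_card_le_1: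
  assumes "finite F" "\<And>k. k \<in> F \<Longrightarrow> real_vec k \<in> L a"
  shows "p m * exp (- a) * real (card F) \<le> 1"
proof -
  have "real (card F) * (p m * exp (- a)) \<le> sum p F"
    using assms level_lattice by (intro sum_bounded_below) blast
  then show ?thesis
    using sum_le_1[OF assms(1)] by (simp add: mult.commute)
qed

lemma finite_lattice_level: "finite {k. real_vec k \<in> L a}"
proof -
  define N where "N = nat \<lceil>1 / (p m * exp (- a))\<rceil>"
  have "card G \<le> N" if "G \<subseteq> {k. real_vec k \<in> L a}" "finite G" for G
  proof -
    have "p m * exp (- a) * real (card G) \<le> 1"
      using that by (intro mode_level_card_le_1) auto
    then have "real (card G) \<le> 1 / (p m * exp (- a))"
      using mode_pos by (simp add: field_simps)
    then show ?thesis
      unfolding N_def by linarith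
  qed
  then show ?thesis
    by (rule finite_if_finite_subsets_card_bdd[THEN conjunct1, rotated]) auto
qed

text \<open>Contracting a point of \<open>L (t * a)\<close> towards the mode, then by one half towards the centre of the
  cube, and rounding, ends in a lattice point of \<open>L a\<close>, and only few lattice points end in the same one.\<close>

lemma level_growth:
  assumes cube: "cube y 1 \<subseteq> L a" and t: "t \<ge> 1"
    and F: "finite F" "\<And>k. k \<in> F \<Longrightarrow> real_vec k \<in> L (t * a)"
  shows "real (card F) \<le> (4 * t + 1) ^ CARD('n) * real (card {k. real_vec k \<in> L a})"
proof (rule card_le_fibers[OF F(1) finite_lattice_level])
  define x where "x k = (1 - 1 / t) *\<^sub>R real_vec m + (1 / t) *\<^sub>R real_vec k" for k
  define z where "z k = (1 / 2) *\<^sub>R (x k + y)" for k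
  define w :: "int ^ 'n \<Rightarrow> int ^ 'n" where "w k = (\<chi> i. round (z k $ i))" for k
  have near: "\<bar>real_vec (w k) $ i - z k $ i\<bar> \<le> 1 / 2" for k i
    unfolding w_def real_vec_def using of_int_round_abs_le[of "z k $ i"] by simp
  show "w ` F \<subseteq> {k. real_vec k \<in> L a}"
  proof clarify
    fix k assume "k \<in> F"
    then have x: "x k \<in> L a"
      unfolding x_def using F(2) t by (intro contract_to_mode) auto
    \<comment> \<open>With this choice \<open>w k\<close> is the midpoint of \<open>x k\<close> and
      \<open>y'\<close>. The rounding error of at most one half is doubled, which is why a cube of
      half-side 1 is required.\<close>
    define y' where "y' = y + 2 *\<^sub>R (real_vec (w k) - z k)"
    have "y' \<in> cube y 1"
    proof -
      have "\<bar>2 * real_vec (w k) $ i - 2 * z k $ i\<bar> \<le> 1" for i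
        using near[of k i] by linarith
      then show ?thesis by (simp add: cube_def y'_def)
    qed
    then have "(1 - 1 / 2) *\<^sub>R x k + (1 / 2) *\<^sub>R y' \<in> L ((1 - 1 / 2) * a + (1 / 2) * a)"
      using cube x by (intro level_combine) auto
    moreover have "(1 - 1 / 2) *\<^sub>R x k + (1 / 2) *\<^sub>R y' = real_vec (w k)"
      by (simp add: y'_def z_def vec_eq_iff field_simps)
    ultimately show "real_vec (w k) \<in> L a" by simp
  qed
  show "real (card {k \<in> F. w k = v}) \<le> (4 * t + 1) ^ CARD('n)" for v
  proof (cases "{k \<in> F. w k = v} = {}")
    case True
    then have "real (card {k \<in> F. w k = v}) = 0"
      by (simp only: card.empty)
    then show ?thesis using t by simp
  next
    case False
    then obtain k0 where k0: "k0 \<in> F" "w k0 = v" by auto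
    \<comment> \<open>Points with the same rounding have \<open>z\<close> within 1 of each other,
      and \<open>z\<close> scales lattice differences by \<open>1 / (2 * t)\<close>.\<close>
    have "{k \<in> F. w k = v} \<subseteq> {k. real_vec k \<in> cube (real_vec k0) (2 * t)}"
    proof
      fix k assume "k \<in> {k \<in> F. w k = v}"
      then have k: "w k = w k0"
        using k0(2) by simp
      have "\<bar>real_vec k $ i - real_vec k0 $ i\<bar> \<le> 2 * t" for i
      proof -
        have "\<bar>z k $ i - z k0 $ i\<bar> \<le> 1"
          using near[of k i] near[of k0 i] unfolding k by linarith
        moreover have "z k $ i - z k0 $ i = (real_vec k $ i - real_vec k0 $ i) / (2 * t)"
          using t by (simp add: z_def x_def field_simps)
        ultimately show ?thesis
          using t by (simp add: field_simps)
      qed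
      then show "k \<in> {k. real_vec k \<in> cube (real_vec k0) (2 * t)}"
        by (simp add: cube_def)
    qed
    then have "card {k \<in> F. w k = v} \<le> card {k. real_vec k \<in> cube (real_vec k0) (2 * t)}"
      by (intro card_mono finite_lattice_cube)
    then have "real (card {k \<in> F. w k = v}) \<le> real (card {k. real_vec k \<in> cube (real_vec k0) (2 * t)})"
      by simp
    also have "\<dots> \<le> (2 * (2 * t) + 1) ^ CARD('n)"
      using t by (intro card_lattice_cube_le) simp
    finally show ?thesis by simp
  qed
qed

text \<open>Each point of \<open>F\<close> is contracted to the mode by the factor
  \<open>max 1 (depth k / a)\<close>, which brings it into \<open>L a\<close>. The hull of the
  contracted points lies in \<open>L a\<close> and so contains no cube, and
  \<open>cube_or_slab\<close> gives a slab; undoing the contraction multiplies the width by the same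
  factor.\<close>

lemma slab_of_level_without_cube:
  assumes no_cube: "\<nexists>y. cube y r \<subseteq> L a" and r: "r > 0" and a: "a > 0"
    and F: "finite F" "\<And>k. k \<in> F \<Longrightarrow> 0 < p k"
  obtains \<theta> where "norm \<theta> = 1"
    "\<And>k. k \<in> F \<Longrightarrow> \<bar>(real_vec k - real_vec m) \<bullet> \<theta>\<bar> \<le> 2 * real CARD('n) ^ 2 * r * max 1 (depth k / a)"
proof -
  define t where "t k = max 1 (depth k / a)" for k
  define x where "x k = (1 - 1 / t k) *\<^sub>R real_vec m + (1 / t k) *\<^sub>R real_vec k" for k
  have t1: "t k \<ge> 1" for k by (simp add: t_def)
  have xL: "x k \<in> L a" if "k \<in> F" for k
  proof -
    have "depth k \<le> t k * a"
      using a by (simp add: t_def max_def field_simps)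
    then have "real_vec k \<in> L (t k * a)"
      using in_level_depth[OF F(2)[OF that]] level_mono by blast
    then show ?thesis
      unfolding x_def using t1 by (intro contract_to_mode)
  qed
  have "insert (real_vec m) (x ` F) \<subseteq> L a"
    using xL mode_in_level level_mono[of 0 a] a by auto
  then have "convex hull (insert (real_vec m) (x ` F)) \<subseteq> L a"
    by (intro hull_minimal convex_level)
  then obtain \<theta> where th: "norm \<theta> = 1"
    "\<And>u. u \<in> insert (real_vec m) (x ` F) \<Longrightarrow> \<bar>(u - real_vec m) \<bullet> \<theta>\<bar> \<le> 2 * real CARD('n) ^ 2 * r"
    using cube_or_slab[of "insert (real_vec m) (x ` F)" "real_vec m" r] F(1) r no_cube by blast
  have "\<bar>(real_vec k - real_vec m) \<bullet> \<theta>\<bar> \<le> 2 * real CARD('n) ^ 2 * r * max 1 (depth k / a)" if "k \<in> F" for k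
  proof -
    have "real_vec k - real_vec m = t k *\<^sub>R (x k - real_vec m)"
      using t1[of k] by (simp add: x_def vec_eq_iff field_simps)
    then have "\<bar>(real_vec k - real_vec m) \<bullet> \<theta>\<bar> = t k * \<bar>(x k - real_vec m) \<bullet> \<theta>\<bar>"
      using t1[of k] by (simp add: abs_mult)
    also have "\<dots> \<le> t k * (2 * real CARD('n) ^ 2 * r)"
      using t1[of k] that by (intro mult_left_mono th(2)) auto
    finally show ?thesis by (simp add: t_def mult.commute)
  qed
  with th(1) that show ?thesis by blast
qed

section \<open>Second moments about the mode\<close>

lemma second_moment_at_mode:
  "((\<lambda>k. p k * ((real_vec k - real_vec m) $ i * (real_vec k - real_vec m) $ j)) has_sum
     (if i = j then s\<^sup>2 else 0) + real_vec m $ i * real_vec m $ j) UNIV"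
proof -
  let ?a = "real_of_int (m $ i)" and ?b = "real_of_int (m $ j)"
  have "((\<lambda>k. p k * (real_of_int (k $ i) * real_of_int (k $ j)) + ((- ?a) * (p k * real_of_int (k $ j))
      + ((- ?b) * (p k * real_of_int (k $ i)) + ?a * ?b * p k)))
      has_sum ((if i = j then s\<^sup>2 else 0) + ((- ?a) * 0 + ((- ?b) * 0 + ?a * ?b * 1)))) UNIV"
    by (intro has_sum_add has_sum_cmult_right second_moment mean total)
  then show ?thesis
    by (simp add: real_vec_def algebra_simps)
qed

text \<open>The covariance gives \<open>s\<^sup>2\<close> in every unit direction, and moving the
  centre from the mean 0 to the mode only adds a square.\<close>

lemma directional_moment_at_mode:
  assumes "norm \<theta> = 1"
  shows "((\<lambda>k. p k * ((real_vec k - real_vec m) \<bullet> \<theta>)\<^sup>2) has_sum s\<^sup>2 + (real_vec m \<bullet> \<theta>)\<^sup>2) UNIV"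
proof -
  have sq: "(x \<bullet> \<theta>)\<^sup>2 = (\<Sum>i\<in>UNIV. \<Sum>j\<in>UNIV. (\<theta> $ i * \<theta> $ j) * (x $ i * x $ j))" for x
    by (simp add: inner_vec_def power2_eq_square sum_product mult_ac)
  have "((\<lambda>k. \<Sum>i\<in>UNIV. \<Sum>j\<in>UNIV. (\<theta> $ i * \<theta> $ j) *
        (p k * ((real_vec k - real_vec m) $ i * (real_vec k - real_vec m) $ j)))
      has_sum (\<Sum>i\<in>UNIV. \<Sum>j\<in>UNIV. (\<theta> $ i * \<theta> $ j) * ((if i = j then s\<^sup>2 else 0) + real_vec m $ i * real_vec m $ j))) UNIV"
    by (intro has_sum_finite_sum has_sum_cmult_right second_moment_at_mode finite)
  moreover have "(\<Sum>i\<in>UNIV. \<Sum>j\<in>UNIV. (\<theta> $ i * \<theta> $ j) * ((if i = j then s\<^sup>2 else 0) + real_vec m $ i * real_vec m $ j))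
      = s\<^sup>2 + (real_vec m \<bullet> \<theta>)\<^sup>2"
  proof -
    have "(\<Sum>i\<in>UNIV. \<Sum>j\<in>UNIV. (\<theta> $ i * \<theta> $ j) * (if i = j then s\<^sup>2 else 0)) = s\<^sup>2 * (\<theta> \<bullet> \<theta>)"
      by (simp add: inner_vec_def sum_distrib_left if_distrib[of "\<lambda>x. _ * x"] mult_ac cong: if_cong)
    also have "\<theta> \<bullet> \<theta> = 1"
      using assms by (simp add: norm_eq_1)
    finally show ?thesis
      unfolding sq by (simp only: distrib_left sum.distrib mult_1_right)
  qed
  ultimately show ?thesis
    unfolding sq by (simp only: sum_distrib_left mult_ac)
qed

text \<open>One finite set has to serve all directions, because \<theta> is found only after
  \<open>F\<close> is fixed. As the directional terms \<open>h\<close> are dominated by the terms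
  \<open>g\<close> with the full norm, what \<open>h\<close> loses outside \<open>F\<close> is at
  most what \<open>g\<close> loses there.\<close>

lemma finite_set_of_variance:
  obtains F where "finite F" "\<And>k. k \<in> F \<Longrightarrow> 0 < p k"
    "\<And>\<theta>. norm \<theta> = 1 \<Longrightarrow> s\<^sup>2 / 2 \<le> (\<Sum>k\<in>F. p k * ((real_vec k - real_vec m) \<bullet> \<theta>)\<^sup>2)"
proof -
  define g where "g k = p k * (norm (real_vec k - real_vec m))\<^sup>2" for k
  define V where "V = (\<Sum>i\<in>UNIV. s\<^sup>2 + real_vec m $ i * real_vec m $ i)"
  have "((\<lambda>k. \<Sum>i\<in>UNIV. p k * ((real_vec k - real_vec m) $ i * (real_vec k - real_vec m) $ i)) has_sum V) UNIV"
    unfolding V_def using second_moment_at_mode[of i i for i] by (intro has_sum_finite_sum) auto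
  moreover have "g = (\<lambda>k. \<Sum>i\<in>UNIV. p k * ((real_vec k - real_vec m) $ i * (real_vec k - real_vec m) $ i))"
    by (simp add: fun_eq_iff g_def power2_norm_eq_inner inner_vec_def sum_distrib_left)
  ultimately have g: "(g has_sum V) UNIV"
    by simp
  obtain F0 where F0: "finite F0" "dist (sum g F0) V \<le> s\<^sup>2 / 2"
    using has_sum_finite_approximation[OF g, of "s\<^sup>2 / 2"] s_pos by auto
  define F where "F = {k \<in> F0. 0 < p k}"
  have p0: "p k = 0" if "\<not> 0 < p k" for k
    using nonneg[of k] that by simp
  have sumF: "sum g F0 = sum g F"
    using F0(1) p0 by (intro sum.mono_neutral_right) (auto simp: F_def g_def)
  show ?thesis
  proof
    show "finite F" "\<And>k. k \<in> F \<Longrightarrow> 0 < p k"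
      using F0(1) by (auto simp: F_def)
    fix \<theta> :: "real ^ 'n" assume th: "norm \<theta> = 1"
    define h where "h k = p k * ((real_vec k - real_vec m) \<bullet> \<theta>)\<^sup>2" for k
    have h: "(h has_sum s\<^sup>2 + (real_vec m \<bullet> \<theta>)\<^sup>2) UNIV"
      unfolding h_def by (rule directional_moment_at_mode[OF th])
    have le: "h k \<le> g k" for k
    proof -
      have "\<bar>(real_vec k - real_vec m) \<bullet> \<theta>\<bar> \<le> norm (real_vec k - real_vec m)"
        using Cauchy_Schwarz_ineq2[of "real_vec k - real_vec m" \<theta>] th by simp
      then have "((real_vec k - real_vec m) \<bullet> \<theta>)\<^sup>2 \<le> (norm (real_vec k - real_vec m))\<^sup>2"
        using power_mono[of "\<bar>(real_vec k - real_vec m) \<bullet> \<theta>\<bar>" _ 2] by simp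
      then show ?thesis
        unfolding h_def g_def using nonneg by (intro mult_left_mono)
    qed
    have "((\<lambda>k. g k + (- 1) * h k) has_sum V + (- 1) * (s\<^sup>2 + (real_vec m \<bullet> \<theta>)\<^sup>2)) UNIV"
      by (intro has_sum_add has_sum_cmult_right g h)
    then have "(\<Sum>k\<in>F. g k + (- 1) * h k) \<le> V + (- 1) * (s\<^sup>2 + (real_vec m \<bullet> \<theta>)\<^sup>2)"
      using le \<open>finite F\<close> by (intro finite_sum_le_has_sum) auto
    then have "sum g F - sum h F \<le> V - s\<^sup>2 - (real_vec m \<bullet> \<theta>)\<^sup>2"
      by (simp add: sum_subtractf)
    moreover have "V - s\<^sup>2 / 2 \<le> sum g F"
      using F0(2) unfolding dist_real_def sumF by linarith
    moreover have "0 \<le> (real_vec m \<bullet> \<theta>)\<^sup>2"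
      by simp
    ultimately have "s\<^sup>2 / 2 \<le> sum h F"
      by linarith
    then show "s\<^sup>2 / 2 \<le> (\<Sum>k\<in>F. p k * ((real_vec k - real_vec m) \<bullet> \<theta>)\<^sup>2)"
      by (simp add: h_def)
  qed
qed

text \<open>Once \<open>L a\<close> contains a unit cube, the number of lattice points of \<open>L (t * a)\<close> grows
  polynomially in \<open>t\<close>, and so the layers \<open>n * a \<le> depth k < (n + 1) * a\<close> carry exponentially decreasing mass.\<close>

lemma layered_moment:
  assumes cube: "cube y 1 \<subseteq> L a" and a: "a \<ge> 1"
    and F: "finite F" "\<And>k. k \<in> F \<Longrightarrow> 0 < p k"
  shows "(\<Sum>k\<in>F. p k * (2 * (real (nat \<lfloor>depth k / a\<rfloor>) + 1))\<^sup>2) \<le> layer_sum CARD('n)"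
proof -
  define l where "l k = nat \<lfloor>depth k / a\<rfloor>" for k
  have layer: "sum p {k \<in> F. l k = n} \<le> (4 * real n + 5) ^ CARD('n) * exp (1 - real n)" for n
  proof (cases "n = 0")
    case True
    have "sum p {k \<in> F. l k = n} \<le> 1 * 1"
      using sum_le_1 F(1) by simp
    also have "\<dots> \<le> (4 * real n + 5) ^ CARD('n) * exp (1 - real n)"
      using True by (intro mult_mono) auto
    finally show ?thesis .
  next
    case False
    then have n: "n \<ge> 1" by simp
    define K where "K = {k. real_vec k \<in> L a}"
    have l: "real n * a \<le> depth k" "depth k \<le> (real n + 1) * a" if "k \<in> F" "l k = n" for k
    proof -
      have "real n = of_int \<lfloor>depth k / a\<rfloor>"
        using that n unfolding l_def by linarith
      then have "real n \<le> depth k / a" "depth k / a \<le> real n + 1"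
        by linarith+
      then show "real n * a \<le> depth k" "depth k \<le> (real n + 1) * a"
        using a by (auto simp: field_simps)
    qed
    have "p k \<le> p m * exp (- (real n * a))" if "k \<in> {k \<in> F. l k = n}" for k
      using that l[of k] mode_pos by (subst p_eq_depth) (auto simp: F(2))
    then have "sum p {k \<in> F. l k = n} \<le> real (card {k \<in> F. l k = n}) * (p m * exp (- (real n * a)))"
      by (rule sum_bounded_above)
    also have "\<dots> \<le> ((4 * (real n + 1) + 1) ^ CARD('n) * real (card K)) * (p m * exp (- (real n * a)))"
    proof (intro mult_right_mono)
      show "real (card {k \<in> F. l k = n}) \<le> (4 * (real n + 1) + 1) ^ CARD('n) * real (card K)"
        unfolding K_def
      proof (rule level_growth[OF cube])
        fix k assume "k \<in> {k \<in> F. l k = n}"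
        then show "real_vec k \<in> L ((real n + 1) * a)"
          using in_level_depth[OF F(2)] level_mono l by blast
      qed (use F(1) in auto)
    qed (use mode_pos in auto)
    \<comment> \<open>Splitting off \<open>p m * exp (- a) * card K\<close>, which is at most 1 by
      the total mass, leaves a pure exponential decay, with exponent at most \<open>1 - n\<close>
      because \<open>a \<ge> 1\<close>.\<close>
    also have "\<dots> = (4 * (real n + 1) + 1) ^ CARD('n) * ((p m * exp (- a) * real (card K)) * exp (a - real n * a))"
      by (simp add: exp_diff exp_minus field_simps)
    also have "\<dots> \<le> (4 * (real n + 1) + 1) ^ CARD('n) * (1 * exp (1 - real n))"
    proof (intro mult_left_mono mult_mono)
      show "p m * exp (- a) * real (card K) \<le> 1"
        unfolding K_def using finite_lattice_level by (rule mode_level_card_le_1) auto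
      have "(real n - 1) * 1 \<le> (real n - 1) * a"
        using a n by (intro mult_left_mono) auto
      then show "exp (a - real n * a) \<le> exp (1 - real n)"
        by (simp add: algebra_simps)
    qed auto
    finally show ?thesis
      by (simp add: algebra_simps)
  qed
  have "(\<Sum>k\<in>F. p k * (2 * (real (l k) + 1))\<^sup>2) = (\<Sum>n\<in>l ` F. \<Sum>k\<in>{k \<in> F. l k = n}. p k * (2 * (real (l k) + 1))\<^sup>2)"
    using F(1) by (rule sum.image_gen)
  also have "\<dots> = (\<Sum>n\<in>l ` F. (2 * (real n + 1))\<^sup>2 * sum p {k \<in> F. l k = n})"
    by (intro sum.cong) (auto simp: sum_distrib_right mult.commute)
  also have "\<dots> \<le> (\<Sum>n\<in>l ` F. (2 * (real n + 1))\<^sup>2 * ((4 * real n + 5) ^ CARD('n) * exp (1 - real n)))"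
    by (intro sum_mono mult_left_mono layer) auto
  also have "\<dots> \<le> layer_sum CARD('n)"
    using sum_layers_le[of "l ` F"] F(1) by (simp add: mult.assoc)
  finally show ?thesis
    by (simp add: l_def)
qed

text \<open>If the levels \<open>2 ^ j\<close> are doubled until one contains a cube of side comparable to \<open>s\<close>, the
  previous level lies in a thin slab, while the lattice points of depth beyond the last one are
  controlled by \<open>layered_moment\<close>; thus the variance orthogonal to the slab is too small.\<close>

lemma cube_in_first_level:
  fixes r :: real
  defines "r \<equiv> s / (4 * real CARD('n) ^ 2 * layer_sum CARD('n))"
  assumes r1: "r \<ge> 1"
  obtains y where "cube y r \<subseteq> L 1"
proof -
  define S where "S = layer_sum CARD('n)"
  define C where "C = 2 * real CARD('n) ^ 2 * r"
  have S: "S \<ge> 1"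
    by (simp add: S_def layer_sum_ge_1)
  have d: "real CARD('n) \<ge> 1"
    using zero_less_card_finite[where 'a='n] by linarith
  have C: "C = s / (2 * S)"
    using d S by (simp add: C_def r_def S_def field_simps)
  \<comment> \<open>The constant in \<open>r\<close> is chosen for this inequality: the second
    moment that slab and layers allow stays below half the variance.\<close>
  have CS: "C\<^sup>2 * S < s\<^sup>2 / 2"
  proof -
    have "C\<^sup>2 * S = s\<^sup>2 / (4 * S)"
      using S by (simp add: C power2_eq_square field_simps)
    also have "\<dots> \<le> s\<^sup>2 / (4 * 1)"
      using S by (intro divide_left_mono) auto
    also have "\<dots> < s\<^sup>2 / 2"
      using s_pos by simp
    finally show ?thesis .
  qed
  obtain F where F: "finite F" "\<And>k. k \<in> F \<Longrightarrow> 0 < p k"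
    and var: "\<And>\<theta>. norm \<theta> = 1 \<Longrightarrow> s\<^sup>2 / 2 \<le> (\<Sum>k\<in>F. p k * ((real_vec k - real_vec m) \<bullet> \<theta>)\<^sup>2)"
    using finite_set_of_variance by blast
  have slab: False
    if a: "a > 0" and no_cube: "\<nexists>y. cube y r \<subseteq> L a"
      and Q: "(\<Sum>k\<in>F. p k * (max 1 (depth k / a))\<^sup>2) \<le> S" for a
  proof -
    have r0: "r > 0" using r1 by simp
    obtain \<theta> where th: "norm \<theta> = 1"
      "\<And>k. k \<in> F \<Longrightarrow> \<bar>(real_vec k - real_vec m) \<bullet> \<theta>\<bar> \<le> 2 * real CARD('n) ^ 2 * r * max 1 (depth k / a)"
      by (rule slab_of_level_without_cube[OF no_cube r0 a F]) (assumption, rule that)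
    note th = th[folded C_def]
    have "s\<^sup>2 / 2 \<le> (\<Sum>k\<in>F. p k * ((real_vec k - real_vec m) \<bullet> \<theta>)\<^sup>2)"
      by (rule var[OF th(1)])
    also have "\<dots> \<le> (\<Sum>k\<in>F. p k * (C * max 1 (depth k / a))\<^sup>2)"
    proof (intro sum_mono mult_left_mono nonneg)
      fix k assume "k \<in> F"
      from power_mono[OF th(2)[OF this], of 2]
      show "((real_vec k - real_vec m) \<bullet> \<theta>)\<^sup>2 \<le> (C * max 1 (depth k / a))\<^sup>2"
        by simp
    qed
    also have "\<dots> = C\<^sup>2 * (\<Sum>k\<in>F. p k * (max 1 (depth k / a))\<^sup>2)"
      by (simp add: sum_distrib_left power_mult_distrib mult_ac)
    also have "\<dots> \<le> C\<^sup>2 * S"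
      by (intro mult_left_mono Q) simp
    finally show False
      using CS by simp
  qed
  \<comment> \<open>At a level above all depths in \<open>F\<close> every factor
    \<open>max 1 (depth k / a)\<close> is 1, so the weighted sum is at most the total mass and
    \<open>slab\<close> forbids the absence of a cube.\<close>
  have ex: "\<exists>j :: nat. \<exists>y. cube y r \<subseteq> L (2 ^ j)"
  proof (rule ccontr)
    assume none: "\<not> ?thesis"
    obtain j :: nat where j: "Max (insert 1 (depth ` F)) < 2 ^ j"
      using real_arch_pow[of 2] by auto
    have "max 1 (depth k / 2 ^ j) = 1" if "k \<in> F" for k
    proof -
      have "depth k \<le> Max (insert 1 (depth ` F))"
        using that F(1) by (intro Max_ge) auto
      then have "depth k / 2 ^ j \<le> 1" using j by simp
      then show ?thesis by (rule max_absorb1)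
    qed
    then have "(\<Sum>k\<in>F. p k * (max 1 (depth k / 2 ^ j))\<^sup>2) = sum p F"
      by (intro sum.cong) simp_all
    also have "\<dots> \<le> S"
      using sum_le_1[OF F(1)] S by simp
    finally show False
      using slab[of "2 ^ j"] none by auto
  qed
  define j where "j = (LEAST j :: nat. \<exists>y. cube y r \<subseteq> L (2 ^ j))"
  have jy: "\<exists>y. cube y r \<subseteq> L (2 ^ j)"
    unfolding j_def by (rule LeastI_ex[OF ex])
  show ?thesis
  proof (cases j)
    case 0
    then show ?thesis using jy that by auto
  next
    case (Suc i)
    define b :: real where "b = 2 ^ i"
    have b: "b \<ge> 1" by (simp add: b_def)
    have "\<nexists>y. cube y r \<subseteq> L b"
      using not_less_Least[of i "\<lambda>j. \<exists>y. cube y r \<subseteq> L (2 ^ j)"] Suc by (simp add: j_def b_def)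
    \<comment> \<open>The moment bound is available at the level \<open>2 * b\<close>, which has a
      cube, but depth is measured here in units of \<open>b\<close>; the factor 2 inside the square
      of \<open>layered_moment\<close> accounts for this.\<close>
    moreover have "(\<Sum>k\<in>F. p k * (max 1 (depth k / b))\<^sup>2) \<le> S"
    proof -
      obtain y where y: "cube y r \<subseteq> L (2 * b)"
        using jy Suc by (auto simp: b_def)
      have "cube y 1 \<subseteq> cube y r"
        using r1 by (auto simp: cube_def) (meson order_trans)
      then have "cube y 1 \<subseteq> L (2 * b)"
        using y by blast
      then have "(\<Sum>k\<in>F. p k * (2 * (real (nat \<lfloor>depth k / (2 * b)\<rfloor>) + 1))\<^sup>2) \<le> S"
        unfolding S_def using b F by (intro layered_moment) auto
      moreover have "p k * (max 1 (depth k / b))\<^sup>2 \<le> p k * (2 * (real (nat \<lfloor>depth k / (2 * b)\<rfloor>) + 1))\<^sup>2"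
        if "k \<in> F" for k
      proof (intro mult_left_mono power_mono nonneg)
        have "depth k / (2 * b) \<le> real (nat \<lfloor>depth k / (2 * b)\<rfloor>) + 1"
          by linarith
        then have "depth k / b \<le> 2 * (real (nat \<lfloor>depth k / (2 * b)\<rfloor>) + 1)"
          using b by (simp add: field_simps)
        then show "max 1 (depth k / b) \<le> 2 * (real (nat \<lfloor>depth k / (2 * b)\<rfloor>) + 1)"
          by simp
      qed auto
      ultimately show ?thesis
        by (rule order_trans[OF sum_mono, rotated])
    qed
    ultimately show ?thesis
      using slab[of b] b by auto
  qed
qed

end

section \<open>The size of the first level set\<close>

text \<open>\<open>cube_const d * s\<close> is the half-side \<open>r\<close> of
  \<open>cube_in_first_level\<close>.\<close>

definition cube_const :: "nat \<Rightarrow> real" where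
  "cube_const d = 1 / (4 * real d ^ 2 * layer_sum d)"

text \<open>Under the root stand the lattice count in the halved cube, the loss
  \<open>exp (- 1)\<close> on the first level and the constant of \<open>mode_lower\<close>, as they
  meet in \<open>cube_in_level_1_near_origin\<close>; the factor 3 comes from
  \<open>level_1_bounded\<close>.\<close>

definition spread_const :: "nat \<Rightarrow> real" where
  "spread_const d =
     3 * (1 / sqrt ((cube_const d / 2) ^ d * exp (- 1) / (2 * (5 * real d) ^ d)) + cube_const d)"

lemma cube_const_pos: "d \<ge> 1 \<Longrightarrow> 0 < cube_const d"
  using layer_sum_ge_1[of d] by (simp add: cube_const_def)

lemma cube_const_le_1:
  assumes "d \<ge> 1"
  shows "cube_const d \<le> 1"
proof -
  have "1 * 1 \<le> real d ^ 2 * layer_sum d"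
    using assms layer_sum_ge_1[of d] by (intro mult_mono) auto
  moreover have "0 < 4 * real d ^ 2 * layer_sum d"
    using assms layer_sum_ge_1[of d] by simp
  ultimately show ?thesis
    unfolding cube_const_def by (subst divide_le_eq_1_pos) auto
qed

lemma spread_const_pos: "d \<ge> 1 \<Longrightarrow> 0 < spread_const d"
  using cube_const_pos[of d] by (auto simp: spread_const_def intro!: add_pos_pos)

text \<open>The homothety of ratio one half centred at \<open>x\<close> maps the convex set
  \<open>L a\<close> into itself and the given cube onto this one.\<close>

lemma (in lattice_level_sets) subcube_of_level:
  assumes cube: "cube y r \<subseteq> L a" and x: "x \<in> L a"
  shows "cube ((1 / 2) *\<^sub>R (x + y)) (r / 2) \<subseteq> L a"
proof
  fix u assume u: "u \<in> cube ((1 / 2) *\<^sub>R (x + y)) (r / 2)"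
  define y' where "y' = 2 *\<^sub>R u - x"
  have "\<bar>y' $ i - y $ i\<bar> \<le> r" for i
  proof -
    have "\<bar>u $ i - (x $ i / 2 + y $ i / 2)\<bar> \<le> r / 2"
      using u by (simp add: cube_def add_divide_distrib)
    moreover have "y' $ i = 2 * u $ i - x $ i"
      by (simp add: y'_def)
    ultimately show ?thesis
      by linarith
  qed
  then have "y' \<in> L a"
    using cube by (auto simp: cube_def)
  then have "(1 - 1 / 2) *\<^sub>R x + (1 / 2) *\<^sub>R y' \<in> L ((1 - 1 / 2) * a + (1 / 2) * a)"
    using x by (intro level_combine) auto
  then show "u \<in> L a"
    by (simp add: y'_def scaleR_right_diff_distrib)
qed

text \<open>The lower bound on \<open>s\<close> leaves half-side at least 1 even to the halved cube,
  as \<open>card_lattice_cube_ge\<close> demands.\<close>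

locale spread_lattice_level_sets = lattice_level_sets p L m s
  for p :: "int ^ 'n \<Rightarrow> real" and L m s +
  assumes s_large: "2 \<le> cube_const CARD('n) * s"
begin

lemma card_ge_1: "CARD('n) \<ge> 1"
  using zero_less_card_finite[where 'a='n] by linarith

lemma square_term_nonneg: "0 \<le> p k * (real_of_int (k $ i) * real_of_int (k $ i))"
  by (rule mult_nonneg_nonneg[OF nonneg zero_le_square])

lemma s_ge_1: "1 \<le> s"
proof -
  have "cube_const CARD('n) * s \<le> 1 * s"
    using cube_const_le_1[OF card_ge_1] s_pos by (intro mult_right_mono) auto
  then show ?thesis
    using s_large by simp
qed

lemma level_1_contains_cube:
  obtains y where "cube y (cube_const CARD('n) * s) \<subseteq> L 1"
proof -
  have "cube_const CARD('n) * s = s / (4 * real CARD('n) ^ 2 * layer_sum CARD('n))"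
    by (simp add: cube_const_def)
  then show ?thesis
    using cube_in_first_level that s_large by (metis one_le_numeral order_trans)
qed

text \<open>The many lattice points of the cube in \<open>L 1\<close> each have mass at least
  \<open>p m * exp (- 1)\<close>.\<close>

lemma mode_upper: "p m \<le> exp 1 / (cube_const CARD('n) * s) ^ CARD('n)"
proof -
  obtain y where y: "cube y (cube_const CARD('n) * s) \<subseteq> L 1"
    by (rule level_1_contains_cube)
  let ?G = "{k. real_vec k \<in> cube y (cube_const CARD('n) * s)}"
  have pos: "0 < (cube_const CARD('n) * s) ^ CARD('n)"
    using s_large by simp
  have "p m * exp (- 1) * (cube_const CARD('n) * s) ^ CARD('n) \<le> p m * exp (- 1) * real (card ?G)"
    using s_large mode_pos by (intro mult_left_mono card_lattice_cube_ge) auto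
  also have "\<dots> \<le> 1"
    using y by (intro mode_level_card_le_1 finite_lattice_cube) auto
  finally show ?thesis
    using pos by (simp add: exp_minus field_simps)
qed

text \<open>Chebyshev: outside the cube of half-side \<open>R\<close> the mass is at most
  \<open>1 / (4 * d)\<close>, so at least half of it is shared by the at most
  \<open>(5 * d * s) ^ d\<close> lattice points inside, none heavier than the mode.\<close>

lemma mode_lower: "1 / (2 * (5 * real CARD('n)) ^ CARD('n)) \<le> p m * s ^ CARD('n)"
proof -
  define R where "R = 2 * real CARD('n) * s"
  define Q :: "(int ^ 'n) set" where "Q = {k. real_vec k \<in> cube 0 R}"
  have d1: "real CARD('n) \<ge> 1"
    using card_ge_1 by simp
  have R: "R > 0"
    using d1 s_pos by (simp add: R_def)
  have finQ: "finite Q"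
    unfolding Q_def by (rule finite_lattice_cube)
  have Qsum: "((\<lambda>k. if k \<in> Q then p k else 0) has_sum sum p Q) UNIV"
    by (rule has_sum_cong_neutral[THEN iffD1, OF _ _ _ has_sum_finite[OF finQ, of p]]) auto
  have "((\<lambda>k. (if k \<in> Q then p k else 0) + (1 / R\<^sup>2) * (\<Sum>i\<in>UNIV. p k * (real_of_int (k $ i) * real_of_int (k $ i))))
      has_sum sum p Q + (1 / R\<^sup>2) * (\<Sum>i\<in>(UNIV :: 'n set). s\<^sup>2)) UNIV"
    using second_moment[of i i for i]
    by (intro has_sum_add Qsum has_sum_cmult_right has_sum_finite_sum) auto
  moreover have "p k \<le> (if k \<in> Q then p k else 0) + (1 / R\<^sup>2) * (\<Sum>i\<in>UNIV. p k * (real_of_int (k $ i) * real_of_int (k $ i)))" for k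
  proof (cases "k \<in> Q")
    case True
    then show ?thesis
      using square_term_nonneg[of k] by (simp add: sum_nonneg)
  next
    case False
    then obtain i where "R < \<bar>real_of_int (k $ i)\<bar>"
      by (auto simp: Q_def cube_def real_vec_def not_le)
    then have "R\<^sup>2 \<le> \<bar>real_of_int (k $ i)\<bar>\<^sup>2"
      using R by (intro power_mono) auto
    then have "R\<^sup>2 * p k \<le> (real_of_int (k $ i) * real_of_int (k $ i)) * p k"
      using nonneg by (intro mult_right_mono) (auto simp: power2_eq_square)
    also have "\<dots> = p k * (real_of_int (k $ i) * real_of_int (k $ i))"
      by (rule mult.commute)
    also have "\<dots> \<le> (\<Sum>i\<in>UNIV. p k * (real_of_int (k $ i) * real_of_int (k $ i)))"
      using square_term_nonneg by (intro member_le_sum) simp_all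
    finally show ?thesis
      using R False by (simp add: field_simps)
  qed
  ultimately have "1 \<le> sum p Q + (1 / R\<^sup>2) * (\<Sum>i\<in>(UNIV :: 'n set). s\<^sup>2)"
    using has_sum_mono[OF total] by blast
  also have "(1 / R\<^sup>2) * (\<Sum>i\<in>(UNIV :: 'n set). s\<^sup>2) = 1 / (4 * real CARD('n))"
    using s_pos d1 by (simp add: R_def power2_eq_square field_simps)
  also have "\<dots> \<le> 1 / 4"
    using d1 by (simp add: field_simps)
  finally have "1 / 2 \<le> sum p Q" by simp
  also have "\<dots> \<le> real (card Q) * p m"
    by (rule sum_bounded_above) (rule mode)
  also have "\<dots> \<le> (5 * real CARD('n) * s) ^ CARD('n) * p m"
  proof (rule mult_right_mono)
    have "real (card Q) \<le> (2 * R + 1) ^ CARD('n)"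
      unfolding Q_def using R by (intro card_lattice_cube_le) simp
    also have "\<dots> \<le> (5 * real CARD('n) * s) ^ CARD('n)"
    proof (rule power_mono)
      have "1 * 1 \<le> real CARD('n) * s"
        using d1 s_ge_1 by (intro mult_mono) auto
      then show "2 * R + 1 \<le> 5 * real CARD('n) * s"
        by (simp add: R_def mult.commute)
    qed (use R in auto)
    finally show "real (card Q) \<le> (5 * real CARD('n) * s) ^ CARD('n)" .
  qed (use mode_pos in simp)
  finally show ?thesis
    using d1 by (simp add: power_mult_distrib field_simps)
qed

text \<open>The lattice points of the cube have \<open>i\<close>-th coordinate at least
  \<open>h\<close> in absolute value and, by \<open>mode_lower\<close>, a fixed share of the total
  mass; a large \<open>h\<close> would exceed the second moment.\<close>

lemma cube_in_level_1_near_origin: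
  assumes cube: "cube z (cube_const CARD('n) * s / 2) \<subseteq> L 1"
  shows "\<bar>z $ i\<bar> \<le> spread_const CARD('n) / 3 * s"
proof -
  define r where "r = cube_const CARD('n) * s / 2"
  define h where "h = \<bar>z $ i\<bar> - r"
  define \<kappa> where "\<kappa> = (cube_const CARD('n) / 2) ^ CARD('n) * exp (- 1) / (2 * (5 * real CARD('n)) ^ CARD('n))"
  have c: "cube_const CARD('n) > 0"
    by (rule cube_const_pos[OF card_ge_1])
  have k0: "\<kappa> > 0"
    using c card_ge_1 by (simp add: \<kappa>_def)
  have "h \<le> s / sqrt \<kappa>"
  proof (cases "h \<le> 0")
    case True
    then show ?thesis
      using s_pos k0 by (smt (verit) divide_nonneg_nonneg real_sqrt_ge_zero)
  next
    case False
    define G where "G = {k. real_vec k \<in> cube z r}"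
    have finG: "finite G"
      unfolding G_def by (rule finite_lattice_cube)
    have "\<kappa> * h\<^sup>2 = ((cube_const CARD('n) / 2) ^ CARD('n) * exp (- 1) * h\<^sup>2) * (1 / (2 * (5 * real CARD('n)) ^ CARD('n)))"
      by (simp add: \<kappa>_def)
    also have "\<dots> \<le> ((cube_const CARD('n) / 2) ^ CARD('n) * exp (- 1) * h\<^sup>2) * (p m * s ^ CARD('n))"
      using c by (intro mult_left_mono mode_lower) auto
    also have "\<dots> = r ^ CARD('n) * (p m * exp (- 1) * h\<^sup>2)"
      by (simp add: r_def power_mult_distrib power_divide field_simps)
    also have "\<dots> \<le> real (card G) * (p m * exp (- 1) * h\<^sup>2)"
      unfolding G_def using s_large mode_pos
      by (intro mult_right_mono card_lattice_cube_ge) (auto simp: r_def)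
    also have "\<dots> \<le> (\<Sum>k\<in>G. p k * (real_of_int (k $ i) * real_of_int (k $ i)))"
    proof (rule sum_bounded_below)
      fix k assume k: "k \<in> G"
      then have "p m * exp (- 1) \<le> p k"
        using cube level_lattice by (auto simp: G_def r_def)
      moreover have "h\<^sup>2 \<le> real_of_int (k $ i) * real_of_int (k $ i)"
      proof -
        have "\<bar>real_of_int (k $ i) - z $ i\<bar> \<le> r"
          using k by (simp add: G_def cube_def real_vec_def)
        then have "h \<le> \<bar>real_of_int (k $ i)\<bar>"
          unfolding h_def by linarith
        from power_mono[OF this, of 2] False show ?thesis
          by (simp add: power2_eq_square)
      qed
      ultimately show "p m * exp (- 1) * h\<^sup>2 \<le> p k * (real_of_int (k $ i) * real_of_int (k $ i))"
        using nonneg by (intro mult_mono) auto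
    qed
    also have "\<dots> \<le> s\<^sup>2"
      using second_moment[of i i] finG square_term_nonneg
      by (intro finite_sum_le_has_sum[where A = UNIV]) simp_all
    finally have "(h * sqrt \<kappa>)\<^sup>2 \<le> s\<^sup>2"
      using k0 by (simp add: power_mult_distrib mult.commute)
    then have "h * sqrt \<kappa> \<le> s"
      by (rule power2_le_imp_le) (use s_pos in simp)
    then show ?thesis
      using k0 by (simp add: field_simps)
  qed
  moreover have "r \<le> cube_const CARD('n) * s"
    using c s_pos by (simp add: r_def)
  ultimately have "\<bar>z $ i\<bar> \<le> s / sqrt \<kappa> + cube_const CARD('n) * s"
    by (simp add: h_def)
  also have "\<dots> = spread_const CARD('n) / 3 * s"
    by (simp add: spread_const_def \<kappa>_def field_simps)
  finally show ?thesis .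
qed

text \<open>Both \<open>y\<close> and the midpoint of \<open>x\<close> and \<open>y\<close> are
  centres of halved cubes in \<open>L 1\<close>, hence near the origin, and \<open>x\<close> is
  twice the midpoint minus \<open>y\<close>.\<close>

lemma level_1_bounded:
  assumes x: "x \<in> L 1"
  shows "\<bar>x $ i\<bar> \<le> spread_const CARD('n) * s"
proof -
  obtain y where y: "cube y (cube_const CARD('n) * s) \<subseteq> L 1"
    by (rule level_1_contains_cube)
  have "0 \<le> cube_const CARD('n) * s"
    using s_large by simp
  then have "y \<in> cube y (cube_const CARD('n) * s)"
    by (simp add: cube_def)
  then have "y \<in> L 1"
    using y by blast
  define B where "B = spread_const CARD('n) / 3 * s"
  have "\<bar>((1 / 2) *\<^sub>R (x + y)) $ i\<bar> \<le> B"
    unfolding B_def using subcube_of_level[OF y x] by (rule cube_in_level_1_near_origin)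
  moreover have "\<bar>((1 / 2) *\<^sub>R (y + y)) $ i\<bar> \<le> B"
    unfolding B_def using subcube_of_level[OF y \<open>y \<in> L 1\<close>] by (rule cube_in_level_1_near_origin)
  moreover have "((1 / 2) *\<^sub>R (x + y)) $ i = x $ i / 2 + y $ i / 2" "((1 / 2) *\<^sub>R (y + y)) $ i = y $ i"
    by (simp_all add: add_divide_distrib)
  ultimately have "\<bar>x $ i\<bar> \<le> 3 * B"
    by linarith
  then show ?thesis
    by (simp add: B_def)
qed

text \<open>Contracting \<open>k\<close> to the mode by the factor \<open>t\<close> lands in the
  bounded set \<open>L 1\<close>, so coordinates grow at most linearly with depth. The factor
  \<open>exp 1\<close> pays for replacing the depth by its maximum with 1.\<close>

lemma tail_bound:
  "p k \<le> p m * exp 1 * exp (- norm_1 (real_vec k) / (3 * real CARD('n) * spread_const CARD('n) * s))"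
proof (cases "0 < p k")
  case False
  then have "p k \<le> 0" by simp
  also have "0 \<le> p m * exp 1 * exp (- norm_1 (real_vec k) / (3 * real CARD('n) * spread_const CARD('n) * s))"
    using mode_pos by simp
  finally show ?thesis .
next
  case True
  define C where "C = spread_const CARD('n) * s"
  define t where "t = max 1 (depth k)"
  have C: "C > 0"
    unfolding C_def using spread_const_pos[OF card_ge_1] s_pos by simp
  have t: "t \<ge> 1" "t \<le> 1 + depth k"
    using depth_nonneg[OF True] by (auto simp: t_def)
  have "real_vec k \<in> L (t * 1)"
    using in_level_depth[OF True] level_mono[of "depth k" t] by (auto simp: t_def)
  then have x: "(1 - 1 / t) *\<^sub>R real_vec m + (1 / t) *\<^sub>R real_vec k \<in> L 1" (is "?x \<in> _")
    using t(1) by (rule contract_to_mode)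
  have m1: "real_vec m \<in> L 1"
    using mode_in_level level_mono[of 0 1] by auto
  have coord: "\<bar>real_vec k $ i\<bar> \<le> 3 * C * (1 + depth k)" for i
  proof -
    have "real_vec k $ i = t * ?x $ i - (t - 1) * real_vec m $ i"
      using t(1) by (simp add: field_simps)
    also have "\<bar>\<dots>\<bar> \<le> t * \<bar>?x $ i\<bar> + (t - 1) * \<bar>real_vec m $ i\<bar>"
      using t(1) by (intro order_trans[OF abs_triangle_ineq4]) (simp add: abs_mult)
    also have "\<dots> \<le> t * C + (t - 1) * C"
      unfolding C_def using t(1) level_1_bounded[OF x] level_1_bounded[OF m1]
      by (intro add_mono mult_left_mono) auto
    also have "\<dots> \<le> 3 * C * t"
      using C t(1) by (simp add: algebra_simps)
    also have "\<dots> \<le> 3 * C * (1 + depth k)"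
      using C t(2) by (intro mult_left_mono) auto
    finally show ?thesis .
  qed
  have "norm_1 (real_vec k) \<le> real CARD('n) * (3 * C * (1 + depth k))"
    unfolding norm_1_def by (rule sum_bounded_above) (rule coord)
  then have "norm_1 (real_vec k) / (3 * real CARD('n) * C) \<le> 1 + depth k"
    using C card_ge_1 by (simp add: divide_le_eq mult_ac)
  then have "- depth k \<le> 1 + - norm_1 (real_vec k) / (3 * real CARD('n) * C)"
    by simp
  then have "exp (- depth k) \<le> exp 1 * exp (- norm_1 (real_vec k) / (3 * real CARD('n) * C))"
    by (metis exp_add exp_le_cancel_iff)
  then have "p m * exp (- depth k) \<le> p m * (exp 1 * exp (- norm_1 (real_vec k) / (3 * real CARD('n) * C)))"
    using mode_pos by (intro mult_left_mono) auto
  then show ?thesis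
    using p_eq_depth[OF True] by (simp add: C_def mult.assoc)
qed

section \<open>Unimodality along coordinate lines\<close>

lemma line_quasiconcave:
  assumes "a \<le> b" "b \<le> c"
  shows "min (p (k + axis i a)) (p (k + axis i c)) \<le> p (k + axis i b)"
proof -
  define v where "v = min (p (k + axis i a)) (p (k + axis i c))"
  \<comment> \<open>The level \<alpha> needs a positive \<open>v\<close> and the weight
    \<open>t\<close> needs \<open>a < c\<close>; then convexity of \<open>L \<alpha>\<close>
    applies.\<close>
  consider "v \<le> 0" | "a = c" | "0 < v" "a < c"
    using assms by linarith
  then have "v \<le> p (k + axis i b)"
  proof cases
    case 1
    then show ?thesis using nonneg order_trans by blast
  next
    case 2
    then show ?thesis using assms by (simp add: v_def)
  next
    case 3
    define \<alpha> where "\<alpha> = ln (p m / v)"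
    have v: "v = p m * exp (- \<alpha>)"
      using 3(1) mode_pos by (simp add: \<alpha>_def ln_div exp_diff)
    define t where "t = (real_of_int b - real_of_int a) / (real_of_int c - real_of_int a)"
    have t: "0 \<le> t" "t \<le> 1" "t * (real_of_int c - real_of_int a) = real_of_int b - real_of_int a"
      using 3(2) assms by (auto simp: t_def field_simps)
    have eq: "(1 - t) *\<^sub>R real_vec (k + axis i a) + t *\<^sub>R real_vec (k + axis i c) = real_vec (k + axis i b)"
      using t(3) by (auto simp: vec_eq_iff real_vec_def axis_def algebra_simps)
    have "real_vec (k + axis i a) \<in> L \<alpha>" "real_vec (k + axis i c) \<in> L \<alpha>"
      unfolding level_lattice v[symmetric] by (auto simp: v_def)
    from level_combine[OF this t(1,2)] have "real_vec (k + axis i b) \<in> L \<alpha>"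
      unfolding eq by (simp add: algebra_simps)
    then show ?thesis
      unfolding level_lattice v[symmetric] .
  qed
  then show ?thesis
    by (simp add: v_def)
qed

end

section \<open>Total variation in a coordinate direction\<close>

lemma sum_int_telescope:
  fixes g :: "int \<Rightarrow> real"
  assumes "a \<le> b + 1"
  shows "(\<Sum>n\<in>{a..b}. g n - g (n - 1)) = g b - g (a - 1)"
proof -
  have "(\<Sum>n\<in>{a..c - 1}. g n - g (n - 1)) = g (c - 1) - g (a - 1)" if "a \<le> c" for c
    using that
  proof (induction c rule: int_ge_induct)
    case (step c)
    then have "{a..c + 1 - 1} = insert c {a..c - 1}" by auto
    then show ?case using step.IH by simp
  qed simp
  from this[of "b + 1"] show ?thesis using assms by simp
qed

lemma variation_quasiconcave:
  fixes q :: "int \<Rightarrow> real"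
  assumes qc: "\<And>a b c. \<lbrakk>a \<le> b; b \<le> c\<rbrakk> \<Longrightarrow> min (q a) (q c) \<le> q b"
    and nonneg: "\<And>n. 0 \<le> q n" and bound: "\<And>n. q n \<le> Q"
  shows "(\<Sum>n\<in>{- int J..int J}. \<bar>q n - q (n - 1)\<bar>) \<le> 2 * Q"
proof -
  \<comment> \<open>One point is added on the left because the first difference involves
    \<open>q (- J - 1)\<close>.\<close>
  let ?I = "{- int J - 1..int J}"
  have "Max (q ` ?I) \<in> q ` ?I"
    by (intro Max_in) auto
  then obtain c where c: "c \<in> ?I" "q c = Max (q ` ?I)"
    by (metis imageE)
  have max: "q n \<le> q c" if "n \<in> ?I" for n
    unfolding c(2) using that by (intro Max_ge) auto
  \<comment> \<open>Reflecting the decreasing part at the height of the maximum makes all increments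
    nonnegative, so that the absolute differences telescope.\<close>
  define g where "g n = (if n \<le> c then q n else 2 * q c - q n)" for n
  have "\<bar>q n - q (n - 1)\<bar> = g n - g (n - 1)" if n: "n \<in> {- int J..int J}" for n
  proof (cases "n \<le> c")
    case True
    have "q (n - 1) \<le> q n"
      using qc[of "n - 1" n c] max[of "n - 1"] True n by auto
    then show ?thesis using True by (simp add: g_def)
  next
    case False
    have "q n \<le> q (n - 1)"
      using qc[of c "n - 1" n] max[of n] False n by auto
    moreover have "g (n - 1) = 2 * q c - q (n - 1)"
      using False by (cases "n - 1 = c") (auto simp: g_def)
    ultimately show ?thesis using False by (simp add: g_def)
  qed
  then have "(\<Sum>n\<in>{- int J..int J}. \<bar>q n - q (n - 1)\<bar>) = (\<Sum>n\<in>{- int J..int J}. g n - g (n - 1))"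
    by (rule sum.cong[OF refl])
  also have "\<dots> = g (int J) - g (- int J - 1)"
    by (rule sum_int_telescope) simp
  also have "\<dots> \<le> 2 * q c"
    using c(1) nonneg[of "int J"] nonneg[of "- int J - 1"] nonneg[of c] by (auto simp: g_def)
  also have "\<dots> \<le> 2 * Q"
    using bound by simp
  finally show ?thesis .
qed

text \<open>Two geometric series of ratio \<open>x\<close>, each at most \<open>1 + \<tau>\<close>
  because \<open>exp (1 / \<tau>) \<ge> 1 + 1 / \<tau>\<close>.\<close>

lemma sum_exp_abs_le:
  assumes tau: "\<tau> \<ge> (1 :: real)"
  shows "(\<Sum>n\<in>{- int J..int J}. exp (- \<bar>real_of_int n\<bar> / \<tau>)) \<le> 4 * \<tau>"
proof -
  define x where "x = exp (- 1 / \<tau>)"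
  define e where "e n = exp (- \<bar>real_of_int n\<bar> / \<tau>)" for n
  have e_nat: "e (int n) = x ^ n" "e (- int n) = x ^ n" for n
    by (simp_all add: e_def x_def exp_of_nat_mult[symmetric])
  have x0: "0 < x" "x < 1"
    using tau by (auto simp: x_def)
  have "1 + 1 / \<tau> \<le> exp (1 / \<tau>)"
    by (rule exp_ge_add_one_self)
  then have "x * (1 + 1 / \<tau>) \<le> x * exp (1 / \<tau>)"
    using x0 by (intro mult_left_mono) auto
  also have "\<dots> = 1"
    by (simp add: x_def exp_add[symmetric])
  finally have "1 \<le> (1 + \<tau>) * (1 - x)"
    using tau by (simp add: field_simps)
  then have geo: "1 / (1 - x) \<le> 1 + \<tau>"
    using x0 by (simp add: field_simps)
  have half: "(\<Sum>n\<in>{0..J}. x ^ n) \<le> 1 + \<tau>"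
  proof -
    have "(\<Sum>n\<in>{0..J}. x ^ n) \<le> (\<Sum>n. x ^ n)"
      using x0 by (intro sum_le_suminf summable_geometric) auto
    also have "\<dots> = 1 / (1 - x)"
      using x0 by (intro suminf_geometric) auto
    finally show ?thesis using geo by simp
  qed
  have "{- int J..int J} \<subseteq> int ` {0..J} \<union> (\<lambda>n. - int n) ` {0..J}"
  proof
    fix n assume n: "n \<in> {- int J..int J}"
    show "n \<in> int ` {0..J} \<union> (\<lambda>n. - int n) ` {0..J}"
    proof (cases "0 \<le> n")
      case True
      then show ?thesis using n by (intro UnI1 image_eqI[of _ _ "nat n"]) auto
    next
      case False
      then show ?thesis using n by (intro UnI2 image_eqI[of _ _ "nat (- n)"]) auto
    qed
  qed
  then have "sum e {- int J..int J} \<le> sum e (int ` {0..J} \<union> (\<lambda>n. - int n) ` {0..J})"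
    by (intro sum_mono2) (auto simp: e_def)
  also have "\<dots> \<le> sum e (int ` {0..J}) + sum e ((\<lambda>n. - int n) ` {0..J})"
    by (subst sum_Un) (auto simp: e_def intro!: sum_nonneg)
  also have "\<dots> = (\<Sum>n\<in>{0..J}. x ^ n) + (\<Sum>n\<in>{0..J}. x ^ n)"
    by (simp add: sum.reindex inj_on_def e_nat)
  also have "\<dots> \<le> 4 * \<tau>"
    using half tau by simp
  finally show ?thesis
    by (simp add: e_def)
qed

text \<open>The box is fibred into lines in direction \<open>i\<close>, based at points whose \<open>i\<close>-th coordinate is zero.\<close>

lemma variation_box_le:
  fixes p :: "int ^ 'n \<Rightarrow> real"
  assumes qc: "\<And>k a b c. \<lbrakk>a \<le> b; b \<le> c\<rbrakk> \<Longrightarrow> min (p (k + axis i a)) (p (k + axis i c)) \<le> p (k + axis i b)"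
    and nonneg: "\<And>k. 0 \<le> p k"
    and bound: "\<And>k. p k \<le> A * exp (- norm_1 (real_vec k) / \<tau>)"
    and A: "A \<ge> 0" and tau: "\<tau> \<ge> 1"
  shows "(\<Sum>k\<in>{k. \<forall>l. k $ l \<in> {- int J..int J}}. \<bar>p k - p (k - axis i 1)\<bar>) \<le> 2 * A * (4 * \<tau>) ^ (CARD('n) - 1)"
proof -
  define S where "S l = (if l = i then {0} else {- int J..int J})" for l
  define base where "base = {k :: int ^ 'n. \<forall>l. k $ l \<in> S l}"
  have finS: "finite (S l)" for l by (simp add: S_def)
  have "bij_betw (\<lambda>(k, n). k + axis i n) (base \<times> {- int J..int J}) {k. \<forall>l. k $ l \<in> {- int J..int J}}"
    by (rule bij_betw_byWitness[where f' = "\<lambda>k. (k - axis i (k $ i), k $ i)"])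
       (auto simp: base_def S_def axis_def vec_eq_iff split: if_splits)
  then have "(\<Sum>k\<in>{k. \<forall>l. k $ l \<in> {- int J..int J}}. \<bar>p k - p (k - axis i 1)\<bar>)
      = (\<Sum>(k, n)\<in>base \<times> {- int J..int J}. \<bar>p (k + axis i n) - p (k + axis i n - axis i 1)\<bar>)"
    by (subst sum.reindex_bij_betw[symmetric]) (auto simp: case_prod_unfold)
  also have "\<dots> = (\<Sum>k\<in>base. \<Sum>n\<in>{- int J..int J}. \<bar>p (k + axis i n) - p (k + axis i (n - 1))\<bar>)"
  proof -
    have eq: "k + axis i n - axis i 1 = k + axis i (n - 1)" for k :: "int ^ 'n" and n
      by (simp add: axis_def vec_eq_iff)
    show ?thesis
      unfolding sum.cartesian_product by (simp only: eq)
  qed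
  also have "\<dots> \<le> (\<Sum>k\<in>base. 2 * (A * exp (- norm_1 (real_vec k) / \<tau>)))"
  proof (rule sum_mono)
    fix k assume "k \<in> base"
    then have "k $ i \<in> S i" by (simp add: base_def)
    then have "k $ i = 0" by (simp add: S_def)
    \<comment> \<open>The base point has the smallest norm on its line, so its tail bound holds
      along the whole line.\<close>
    then have "norm_1 (real_vec k) \<le> norm_1 (real_vec (k + axis i n))" for n
      unfolding norm_1_def by (intro sum_mono) (auto simp: real_vec_def axis_def)
    then have "p (k + axis i n) \<le> A * exp (- norm_1 (real_vec k) / \<tau>)" for n
      using bound[of "k + axis i n"] A tau
      by (elim order_trans) (auto intro!: mult_left_mono divide_right_mono)
    then show "(\<Sum>n\<in>{- int J..int J}. \<bar>p (k + axis i n) - p (k + axis i (n - 1))\<bar>)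
        \<le> 2 * (A * exp (- norm_1 (real_vec k) / \<tau>))"
      using qc nonneg by (intro variation_quasiconcave) auto
  qed
  also have "\<dots> = 2 * A * (\<Sum>k\<in>base. \<Prod>l\<in>UNIV. exp (- \<bar>real_of_int (k $ l)\<bar> / \<tau>))"
    by (simp add: norm_1_def real_vec_def sum_distrib_left exp_sum[symmetric] sum_negf sum_divide_distrib mult_ac)
  also have "\<dots> = 2 * A * (\<Prod>l\<in>UNIV. \<Sum>n\<in>S l. exp (- \<bar>real_of_int n\<bar> / \<tau>))"
    unfolding base_def by (subst sum_vec_box) (use finS in auto)
  \<comment> \<open>The direction \<open>i\<close> contributes only a factor 1; this missing power
    of \<tau> produces the decay of the total variation.\<close>
  also have "\<dots> \<le> 2 * A * (\<Prod>l\<in>UNIV. if l = i then 1 else 4 * \<tau>)"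
    using A sum_exp_abs_le[OF tau, of J]
    by (intro mult_left_mono prod_mono) (auto simp: S_def intro: sum_nonneg)
  also have "(\<Prod>l\<in>UNIV. if l = i then 1 else 4 * \<tau>) = (4 * \<tau>) ^ (CARD('n) - 1)"
    by (simp add: prod.If_cases Collect_neg_eq Compl_eq_Diff_UNIV card_Diff_singleton)
  finally show ?thesis .
qed

text \<open>Every finite set lies in a box, and the bound for boxes does not depend on
  \<open>J\<close>; this yields summability as well as the estimate.\<close>

lemma variation_le:
  fixes p :: "int ^ 'n \<Rightarrow> real"
  assumes qc: "\<And>k a b c. \<lbrakk>a \<le> b; b \<le> c\<rbrakk> \<Longrightarrow> min (p (k + axis i a)) (p (k + axis i c)) \<le> p (k + axis i b)"
    and nonneg: "\<And>k. 0 \<le> p k"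
    and bound: "\<And>k. p k \<le> A * exp (- norm_1 (real_vec k) / \<tau>)"
    and A: "A \<ge> 0" and tau: "\<tau> \<ge> 1"
  shows "(\<Sum>\<^sub>\<infinity>k\<in>UNIV. \<bar>p k - p (k - axis i 1)\<bar>) \<le> 2 * A * (4 * \<tau>) ^ (CARD('n) - 1)"
proof -
  have fin: "(\<Sum>k\<in>F. \<bar>p k - p (k - axis i 1)\<bar>) \<le> 2 * A * (4 * \<tau>) ^ (CARD('n) - 1)" if "finite F" for F
  proof -
    define J where "J = (\<Sum>k\<in>F. \<Sum>l\<in>UNIV. nat \<bar>k $ l\<bar>)"
    have "nat \<bar>k $ l\<bar> \<le> J" if "k \<in> F" for k l
    proof -
      have "nat \<bar>k $ l\<bar> \<le> (\<Sum>l\<in>UNIV. nat \<bar>k $ l\<bar>)"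
        by (intro member_le_sum) auto
      also have "\<dots> \<le> J"
        unfolding J_def using \<open>finite F\<close> that by (intro member_le_sum) auto
      finally show ?thesis .
    qed
    then have "k $ l \<in> {- int J..int J}" if "k \<in> F" for k l
      using that by (simp add: nat_le_iff abs_le_iff minus_le_iff)
    then have "F \<subseteq> {k. \<forall>l. k $ l \<in> {- int J..int J}}"
      by blast
    then have "(\<Sum>k\<in>F. \<bar>p k - p (k - axis i 1)\<bar>)
        \<le> (\<Sum>k\<in>{k. \<forall>l. k $ l \<in> {- int J..int J}}. \<bar>p k - p (k - axis i 1)\<bar>)"
      by (intro sum_mono2 finite_vec_box) auto
    also have "\<dots> \<le> 2 * A * (4 * \<tau>) ^ (CARD('n) - 1)"
      using assms by (rule variation_box_le)
    finally show ?thesis .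
  qed
  then have "(\<lambda>k. \<bar>p k - p (k - axis i 1)\<bar>) summable_on UNIV"
    by (intro nonneg_bdd_above_summable_on bdd_aboveI2) auto
  then show ?thesis
    using fin by (rule infsum_le_finite_sums)
qed

section \<open>The discrete log-concave distribution\<close>

text \<open>Only finitely many points are at least as heavy as a given point of positive mass, so
  the supremum is attained.\<close>

lemma pmf_mode_exists:
  obtains m where "0 < pmf p m" "\<And>k. pmf p k \<le> pmf p m"
proof -
  obtain k0 where k0: "0 < pmf p k0"
    using set_pmf_not_empty[of p] by (auto simp: pmf_positive_iff)
  define A where "A = {k. pmf p k0 \<le> pmf p k}"
  have "card G \<le> nat \<lceil>1 / pmf p k0\<rceil>" if "G \<subseteq> A" "finite G" for G
  proof -
    have "real (card G) * pmf p k0 \<le> sum (pmf p) G"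
      using that by (intro sum_bounded_below) (auto simp: A_def)
    also have "\<dots> \<le> 1"
      using measure_measure_pmf_finite[OF that(2), of p] by (metis measure_pmf.prob_le_1)
    finally have "real (card G) \<le> 1 / pmf p k0"
      using k0 by (simp add: field_simps)
    then show ?thesis by linarith
  qed
  then have fin: "finite A"
    by (rule finite_if_finite_subsets_card_bdd[THEN conjunct1, rotated]) auto
  have "Max (pmf p ` A) \<in> pmf p ` A"
    using fin by (intro Max_in) (auto simp: A_def)
  then obtain m where m: "m \<in> A" "pmf p m = Max (pmf p ` A)"
    by (metis imageE)
  have "pmf p k \<le> pmf p m" for k
  proof (cases "k \<in> A")
    case True
    then show ?thesis unfolding m(2) using fin by (intro Max_ge) auto
  next
    case False
    then show ?thesis using m(1) by (simp add: A_def)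
  qed
  moreover have "0 < pmf p m"
    using m(1) k0 by (simp add: A_def)
  ultimately show ?thesis using that by blast
qed

lemma lattice_level_sets_of_log_concave:
  fixes p :: "(int ^ 'n) pmf"
  assumes cent: "centered p" and lc: "log_concave (pmf p)" and cov: "cov_pmf p = mat (s\<^sup>2)" and s: "s > 0"
    and m: "0 < pmf p m" "\<And>k. pmf p k \<le> pmf p m"
  shows "\<exists>L. lattice_level_sets (pmf p) L m s"
proof -
  obtain W where W: "convex_ereal W" "\<And>k. pmf p k = exp_minus (W (real_vec k))"
    using lc unfolding log_concave_def convex_potential_def by auto
  \<comment> \<open>\<open>v\<close> is the potential at the mode, and \<open>L a\<close> is the
    sublevel set of \<open>W\<close> at height \<open>a\<close> above it; convexity of
    \<open>W\<close> gives \<open>level_combine\<close>.\<close>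
  define v where "v = - ln (pmf p m)"
  define L where "L a = {x. W x \<le> ereal (v + a)}" for a
  have "lattice_level_sets (pmf p) L m s"
  proof
    show "(pmf p has_sum 1) UNIV"
      using has_sum_expectation[of p "\<lambda>_. 1"] by simp
    show "((\<lambda>k. pmf p k * real_of_int (k $ i)) has_sum 0) UNIV" for i
      by (rule centered_isotropic_moments[OF cent cov s])
    show "((\<lambda>k. pmf p k * (real_of_int (k $ i) * real_of_int (k $ j))) has_sum (if i = j then s\<^sup>2 else 0)) UNIV" for i j
      by (rule centered_isotropic_moments[OF cent cov s])
    show "L a \<subseteq> L b" if "a \<le> b" for a b
      using that by (auto simp: L_def intro: order_trans)
    show "(1 - t) *\<^sub>R x + t *\<^sub>R y \<in> L ((1 - t) * a + t * b)"
      if "x \<in> L a" "y \<in> L b" "0 \<le> t" "t \<le> 1" for x y a b t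
    proof -
      have "W ((1 - t) *\<^sub>R x + t *\<^sub>R y) \<le> ereal (1 - t) * W x + ereal t * W y"
        using W(1) that(3,4) unfolding convex_ereal_def by auto
      also have "\<dots> \<le> ereal (1 - t) * ereal (v + a) + ereal t * ereal (v + b)"
        using that by (intro add_mono ereal_mult_left_mono) (auto simp: L_def)
      also have "\<dots> = ereal (v + ((1 - t) * a + t * b))"
        by (simp add: algebra_simps)
      finally show ?thesis by (simp add: L_def)
    qed
    show "real_vec k \<in> L a \<longleftrightarrow> pmf p m * exp (- a) \<le> pmf p k" for k a
    proof -
      have e: "pmf p m * exp (- a) = exp (- (v + a))"
        using m(1) by (simp add: v_def exp_diff exp_minus exp_add field_simps)
      show ?thesis
      proof (cases "W (real_vec k)")
        case (real w)
        then show ?thesis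
          unfolding e by (auto simp add: L_def W(2) exp_minus_def)
      next
        case PInf
        then show ?thesis
          unfolding e by (simp add: L_def W(2) exp_minus_def not_le)
      next
        case MInf
        then show ?thesis
          using W(1) by (simp add: convex_ereal_def)
      qed
    qed
  qed (use m s in auto)
  then show ?thesis by blast
qed

theorem theorem20:
  "\<exists>c1 c2 c3 N :: real. c1 > 0 \<and> c2 > 0 \<and> c3 > 0 \<and> N > 0 \<and>
     (\<forall>(p :: (int ^ 'n) pmf) (\<sigma> :: real).
        centered p \<longrightarrow>
        log_concave (pmf p) \<longrightarrow>
        (\<exists>f. log_concave_extension (pmf p) f \<and> isotropic f) \<longrightarrow>
        cov_pmf p = mat (\<sigma>\<^sup>2) \<longrightarrow>
        \<sigma> = det (cov_pmf p) powr (1 / (2 * real CARD('n))) \<longrightarrow>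
        \<sigma> \<ge> N \<longrightarrow>
          (\<exists>m. (\<forall>k. pmf p k \<le> pmf p m) \<and> pmf p m \<le> c1 / \<sigma> ^ CARD('n)) \<and>
          (\<forall>k. infnorm (real_vec k) \<ge> c2 * \<sigma> \<longrightarrow>
             pmf p k \<le> c2 / \<sigma> ^ CARD('n) * exp (- (norm_1 (real_vec k) / (c2 * \<sigma>)))) \<and>
          (\<Sum>i\<in>UNIV. \<Sum>\<^sub>\<infinity>k\<in>UNIV. \<bar>pmf p k - pmf p (k - axis i 1)\<bar>) \<le> c3 / \<sigma>)"
proof -
  define d where "d = CARD('n)"
  define c where "c = cube_const d"
  \<comment> \<open>The summand 1 ensures \<open>T \<ge> 1\<close>, from which
    \<open>\<tau> = T * s\<close> is at least 1 in \<open>variation_le\<close>.\<close>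
  define T where "T = 3 * real d * spread_const d + 1"
  define c1 where "c1 = exp 1 / c ^ d"
  define A where "A = c1 * exp 1"
  define c3 where "c3 = real d * (2 * A * (4 * T) ^ (d - 1))"
  have d: "d \<ge> 1"
    using zero_less_card_finite[where 'a='n] unfolding d_def by linarith
  have c: "c > 0"
    unfolding c_def by (rule cube_const_pos[OF d])
  have sp: "0 < 3 * real d * spread_const d"
    using spread_const_pos[OF d] d by simp
  have T: "T \<ge> 1"
    using sp by (simp add: T_def)
  have c1: "c1 > 0"
    using c by (simp add: c1_def)
  have A: "A > 0"
    using c1 by (simp add: A_def)
  have c3: "c3 > 0"
    using A T d by (simp add: c3_def)
  \<comment> \<open>The sum \<open>A + T\<close> serves as the second constant, since it dominates
    both the prefactor \<open>A\<close> and the decay length \<open>T\<close> of the tail.\<close>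
  have main: "(\<exists>m. (\<forall>k. pmf p k \<le> pmf p m) \<and> pmf p m \<le> c1 / s ^ d) \<and>
          (\<forall>k. infnorm (real_vec k) \<ge> (A + T) * s \<longrightarrow>
             pmf p k \<le> (A + T) / s ^ d * exp (- (norm_1 (real_vec k) / ((A + T) * s)))) \<and>
          (\<Sum>i\<in>UNIV. \<Sum>\<^sub>\<infinity>k\<in>UNIV. \<bar>pmf p k - pmf p (k - axis i 1)\<bar>) \<le> c3 / s"
    if cent: "centered p" and lc: "log_concave (pmf p)" and cov: "cov_pmf p = mat (s\<^sup>2)" and s: "s \<ge> 2 / c"
    for p :: "(int ^ 'n) pmf" and s
  proof -
    have s0: "s > 0"
      using s c by (meson divide_pos_pos less_le_trans zero_less_numeral)
    obtain m where m: "0 < pmf p m" "\<And>k. pmf p k \<le> pmf p m"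
      using pmf_mode_exists by blast
    obtain L where "lattice_level_sets (pmf p) L m s"
      using lattice_level_sets_of_log_concave[OF cent lc cov s0 m] by blast
    then interpret lattice_level_sets "pmf p" L m s .
    \<comment> \<open>The threshold \<open>2 / c\<close> on \<open>s\<close> is the assumption
      \<open>s_large\<close> rearranged.\<close>
    interpret spread_lattice_level_sets "pmf p" L m s
      by unfold_locales (use s c in \<open>simp add: c_def d_def field_simps\<close>)
    have top: "pmf p m \<le> c1 / s ^ d"
      using mode_upper by (simp add: c1_def c_def d_def power_mult_distrib)
    have tail: "pmf p k \<le> A / s ^ d * exp (- norm_1 (real_vec k) / (T * s))" for k
    proof -
      have n0: "0 \<le> norm_1 (real_vec k)"
        by (simp add: norm_1_def sum_nonneg)
      have "pmf p k \<le> pmf p m * exp 1 * exp (- norm_1 (real_vec k) / (3 * real d * spread_const d * s))"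
        using tail_bound[of k] by (simp add: d_def)
      also have "\<dots> \<le> (c1 / s ^ d) * exp 1 * exp (- norm_1 (real_vec k) / (T * s))"
      proof (intro mult_mono top)
        have "3 * real d * spread_const d * s \<le> T * s"
          using s0 by (intro mult_right_mono) (auto simp: T_def)
        then have "norm_1 (real_vec k) / (T * s) \<le> norm_1 (real_vec k) / (3 * real d * spread_const d * s)"
          by (rule frac_le[OF n0 order_refl mult_pos_pos[OF sp s0]])
        then show "exp (- norm_1 (real_vec k) / (3 * real d * spread_const d * s)) \<le> exp (- norm_1 (real_vec k) / (T * s))"
          by simp
      qed (use c1 s0 in auto)
      finally show ?thesis
        by (simp add: A_def)
    qed
    have "pmf p k \<le> (A + T) / s ^ d * exp (- (norm_1 (real_vec k) / ((A + T) * s)))" for k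
    proof -
      have n0: "0 \<le> norm_1 (real_vec k)"
        by (simp add: norm_1_def sum_nonneg)
      have "norm_1 (real_vec k) / ((A + T) * s) \<le> norm_1 (real_vec k) / (T * s)"
        using n0 A T s0 by (intro divide_left_mono) auto
      then have "A / s ^ d * exp (- norm_1 (real_vec k) / (T * s))
          \<le> (A + T) / s ^ d * exp (- (norm_1 (real_vec k) / ((A + T) * s)))"
        using A T s0 by (intro mult_mono divide_right_mono) auto
      with tail[of k] show ?thesis by linarith
    qed
    moreover have "(\<Sum>i\<in>UNIV. \<Sum>\<^sub>\<infinity>k\<in>UNIV. \<bar>pmf p k - pmf p (k - axis i 1)\<bar>) \<le> c3 / s"
    proof -
      have "1 * 1 \<le> T * s"
        using T s_ge_1 by (intro mult_mono) auto
      then have "(\<Sum>\<^sub>\<infinity>k\<in>UNIV. \<bar>pmf p k - pmf p (k - axis i 1)\<bar>) \<le> 2 * (A / s ^ d) * (4 * (T * s)) ^ (CARD('n) - 1)"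
        for i :: 'n
        using A s0 by (intro variation_le line_quasiconcave tail) auto
      then have "(\<Sum>i\<in>UNIV. \<Sum>\<^sub>\<infinity>k\<in>UNIV. \<bar>pmf p k - pmf p (k - axis i 1)\<bar>)
          \<le> real d * (2 * (A / s ^ d) * (4 * (T * s)) ^ (d - 1))"
        unfolding d_def by (intro sum_bounded_above) auto
      \<comment> \<open>Of \<open>s ^ d\<close> in the denominator, \<open>d - 1\<close> powers
        cancel against the sum over the transverse coordinates, and one is left.\<close>
      also have "\<dots> = c3 / s"
      proof -
        have "s ^ d = s * s ^ (d - 1)"
          using d by (simp add: power_eq_if)
        then show ?thesis
          using s0 by (simp add: c3_def power_mult_distrib)
      qed
      finally show ?thesis .
    qed
    ultimately show ?thesis
      using top m(2) by blast
  qed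
  show ?thesis
    by (rule exI[of _ c1], rule exI[of _ "A + T"], rule exI[of _ c3], rule exI[of _ "2 / c"])
       (use c1 A T c3 c main in \<open>auto simp: d_def\<close>)
qed

end
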